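(* Let $\mathcal{M}$ be a Riemannian manifold with Riemannian distance $d$, let $\mathcal{C}\subset\mathcal{M}$ be compact and uniquely geodesically convex, and let $f$ be a geodesically convex function that is geodesically $L$-smooth in $\mathcal{C}$ w.r.t. $d$. Assume that any unconstrained optimum of $f$ lies outside $\mathcal{C}$, and in particular that there exists $c>0$ such that $\min_{x\in\mathcal{C}}\|\nabla f(x)\|_x>c$. Assume that for some $\alpha>0$ the Riemannian scaling inequality holds: for all $x\in\mathcal{C}$, $w\in T_x\mathcal{M}$ and $v\in\operatorname{argmax}_{z\in\mathcal{C}}\langle w;\operatorname{Exp}_x^{-1}(z)\rangle_x$, $$\langle w;\operatorname{Exp}_x^{-1}(v)\rangle_x\ge\alpha\|w\|_x\|\operatorname{Exp}_x^{-1}(v)\|_x^2 .$$ Let $x^*\in\operatorname{argmin}_{x\in\mathcal{C}}f(x)$ and let $(x_t)_{t\ge0}$ be the iterates of the Riemannian Frank--Wolfe algorithm started at any $x_0\in\mathcal{C}$. Then for all $t\ge0$, $$f(x_{t+1})-f(x^* )\le\big(f(x_t)-f(x^* )\big)\max\Big\{\frac12,\ 1-\frac{\alpha c}{2L}\Big\}.$$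
   Context: Geodesics are smooth curves $\gamma:[0,1]\to\mathcal{M}$ with zero covariant acceleration. A closed set $\mathcal{C}\subseteq\mathcal{M}$ is (geodesically) convex if any $x,y\in\mathcal{C}$ are joined by a distance-minimizing geodesic contained in $\mathcal{C}$; it is uniquely geodesic if for any $x,y\in\mathcal{C}$ there is only one geodesic from $x$ to $y$ contained in $\mathcal{C}$; uniquely geodesically convex means both. For $x\in\mathcal{C}$, $\operatorname{Exp}_x^{-1}$ is the inverse of the bijection $\operatorname{Exp}_x:\mathcal{C}_x\to\mathcal{C}$, where $\mathcal{C}_x=\{v\in T_x\mathcal{M}: t\mapsto \operatorname{Exp}_x(tv),\ t\in[0,1],\text{ is minimizing and }\operatorname{Exp}_x(v)\in\mathcal{C}\}$. Thus $d(x,y)=\|\operatorname{Exp}_x^{-1}(y)\|_x$ for $x,y\in\mathcal{C}$. $\nabla f$ is the Riemannian gradient. $f$ is geodesically convex on $\mathcal{C}$ if $f(\gamma(t))\le(1-t)f(x)+tf(y)$ for all $x,y\in\mathcal{C}$, $t\in[0,1]$, with $\gamma$ the geodesic in $\mathcal{C}$ from $x$ to $y$. $f$ is geodesically $L$-smooth in $\mathcal{C}$ w.r.t. $d$ if $|f(y)-f(x)-\langle\nabla f(x);\operatorname{Exp}_x^{-1}(y)\rangle_x|\le\frac L2d^2(x,y)$ for all $x,y\in\mathcal{C}$. Riemannian Frank--Wolfe algorithm: given $x_0\in\mathcal{C}$, for $t=0,1,\dots$: (1) choose $v_t\in\operatorname{argmax}_{v\in\mathcal{C}}\langle-\nabla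 f(x_t);\operatorname{Exp}_{x_t}^{-1}(v)\rangle_{x_t}$; (2) let $s_t\in\operatorname{argmin}_{s\in[0,1]}\; s\langle\nabla f(x_t);\operatorname{Exp}_{x_t}^{-1}(v_t)\rangle_{x_t}+s^2\frac L2d^2(x_t,v_t)$; (3) set $x_{t+1}=\gamma(s_t)$, where $\gamma$ is the geodesic in $\mathcal{C}$ with $\gamma(0)=x_t$, $\gamma(1)=v_t$. *)

theory Defs
  imports "HOL-Analysis.Analysis"
begin

section \<open>Smooth maps between Euclidean spaces\<close>

text \<open>Continuous differentiability of order \<open>k\<close>, meant for open \<open>S\<close>: all directional
  derivatives of a differentiable map are again of class one less.\<close>

primrec Ck_on :: "nat \<Rightarrow> 'a::euclidean_space set \<Rightarrow> ('a \<Rightarrow> 'b::euclidean_space) \<Rightarrow> bool" where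
  "Ck_on 0 S f \<longleftrightarrow> continuous_on S f"
| "Ck_on (Suc k) S f \<longleftrightarrow>
     (\<forall>x\<in>S. f differentiable (at x)) \<and> (\<forall>u. Ck_on k S (\<lambda>x. frechet_derivative f (at x) u))"

text \<open>On a set that need not be open (e.g. a compact interval), smooth means locally extendable
  to a smooth map on an open set.\<close>

definition smooth_on :: "'a::euclidean_space set \<Rightarrow> ('a \<Rightarrow> 'b::euclidean_space) \<Rightarrow> bool" where
  "smooth_on S f \<longleftrightarrow>
     (\<forall>x\<in>S. \<exists>U h. open U \<and> x \<in> U \<and> (\<forall>k. Ck_on k U h) \<and> (\<forall>y\<in>S \<inter> U. h y = f y))"

section \<open>Riemannian manifolds\<close>

text \<open>A manifold is the whole type \<open>'m\<close> with a smooth atlas, modelled on a Euclidean space \<open>'e\<close>.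
  A chart is its domain together with the coordinate map (irrelevant outside the domain).
  A tangent vector at \<open>p\<close> is the family of its components in all charts of the atlas around \<open>p\<close>,
  related by the derivatives of the transition maps, and 0 at every other index;
  the vector space operations are the pointwise ones.\<close>

type_synonym ('m, 'e) chart = "'m set \<times> ('m \<Rightarrow> 'e)"
type_synonym ('m, 'e) tvec = "('m, 'e) chart \<Rightarrow> 'e"

record ('m, 'e) riemannian =
  atlas :: "('m, 'e) chart set"
  metric :: "'m \<Rightarrow> ('m, 'e) tvec \<Rightarrow> ('m, 'e) tvec \<Rightarrow> real"

abbreviation chart_dom :: "('m, 'e) chart \<Rightarrow> 'm set" where
  "chart_dom \<equiv> fst"

abbreviation chart_map :: "('m, 'e) chart \<Rightarrow> 'm \<Rightarrow> 'e" where
  "chart_map \<equiv> snd"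

definition chart_inv :: "('m, 'e) chart \<Rightarrow> 'e \<Rightarrow> 'm" where
  "chart_inv \<kappa> = inv_into (chart_dom \<kappa>) (chart_map \<kappa>)"

definition charts_at :: "('m, 'e) riemannian \<Rightarrow> 'm \<Rightarrow> ('m, 'e) chart set" where
  "charts_at M p = {\<kappa> \<in> atlas M. p \<in> chart_dom \<kappa>}"

definition smooth_atlas ::
    "('m::{t2_space,second_countable_topology}, 'e::euclidean_space) chart set \<Rightarrow> bool" where
  "smooth_atlas A \<longleftrightarrow>
     (\<Union>\<kappa>\<in>A. chart_dom \<kappa>) = UNIV \<and>
     (\<forall>\<kappa>\<in>A. open (chart_dom \<kappa>) \<and> open (chart_map \<kappa> ` chart_dom \<kappa>) \<and>
        homeomorphism (chart_dom \<kappa>) (chart_map \<kappa> ` chart_dom \<kappa>) (chart_map \<kappa>) (chart_inv \<kappa>)) \<and>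
     (\<forall>\<kappa>\<in>A. \<forall>\<kappa>'\<in>A.
        smooth_on (chart_map \<kappa> ` (chart_dom \<kappa> \<inter> chart_dom \<kappa>')) (chart_map \<kappa>' \<circ> chart_inv \<kappa>))"

definition transition_deriv ::
    "('m, 'e::euclidean_space) chart \<Rightarrow> ('m, 'e) chart \<Rightarrow> 'm \<Rightarrow> 'e \<Rightarrow> 'e" where
  "transition_deriv \<kappa> \<kappa>' p =
     frechet_derivative (chart_map \<kappa>' \<circ> chart_inv \<kappa>) (at (chart_map \<kappa> p))"

definition tangent_space ::
    "('m, 'e::euclidean_space) riemannian \<Rightarrow> 'm \<Rightarrow> ('m, 'e) tvec set" where
  "tangent_space M p =
     {v. (\<forall>\<kappa>. \<kappa> \<notin> charts_at M p \<longrightarrow> v \<kappa> = 0) \<and>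
         (\<forall>\<kappa>\<in>charts_at M p. \<forall>\<kappa>'\<in>charts_at M p. v \<kappa>' = transition_deriv \<kappa> \<kappa>' p (v \<kappa>))}"

definition tscale :: "real \<Rightarrow> ('m, 'e::euclidean_space) tvec \<Rightarrow> ('m, 'e) tvec" where
  "tscale a v = (\<lambda>\<kappa>. a *\<^sub>R v \<kappa>)"

definition tadd ::
    "('m, 'e::euclidean_space) tvec \<Rightarrow> ('m, 'e) tvec \<Rightarrow> ('m, 'e) tvec" where
  "tadd u v = (\<lambda>\<kappa>. u \<kappa> + v \<kappa>)"

text \<open>The tangent vector at \<open>p\<close> with components \<open>u\<close> in the chart \<open>\<kappa>\<close>.\<close>

definition coord_vec ::
    "('m, 'e::euclidean_space) riemannian \<Rightarrow> ('m, 'e) chart \<Rightarrow> 'm \<Rightarrow> 'e \<Rightarrow> ('m, 'e) tvec" where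
  "coord_vec M \<kappa> p u = (\<lambda>\<kappa>'. if \<kappa>' \<in> charts_at M p then transition_deriv \<kappa> \<kappa>' p u else 0)"

definition local_metric ::
    "('m, 'e::euclidean_space) riemannian \<Rightarrow> ('m, 'e) chart \<Rightarrow> 'e \<Rightarrow> 'e \<Rightarrow> 'e \<Rightarrow> real" where
  "local_metric M \<kappa> x u w =
     metric M (chart_inv \<kappa> x) (coord_vec M \<kappa> (chart_inv \<kappa> x) u) (coord_vec M \<kappa> (chart_inv \<kappa> x) w)"

definition riemannian_manifold ::
    "('m::{t2_space,second_countable_topology}, 'e::euclidean_space) riemannian \<Rightarrow> bool" where
  "riemannian_manifold M \<longleftrightarrow>
     smooth_atlas (atlas M) \<and>
     (\<forall>p. \<forall>u\<in>tangent_space M p. \<forall>v\<in>tangent_space M p.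
        metric M p u v = metric M p v u \<and>
        (\<forall>w\<in>tangent_space M p. metric M p (tadd u v) w = metric M p u w + metric M p v w) \<and>
        (\<forall>a. metric M p (tscale a u) v = a * metric M p u v)) \<and>
     (\<forall>p. \<forall>u\<in>tangent_space M p. u \<noteq> (\<lambda>_. 0) \<longrightarrow> 0 < metric M p u u) \<and>
     (\<forall>\<kappa>\<in>atlas M. \<forall>u w. smooth_on (chart_map \<kappa> ` chart_dom \<kappa>) (\<lambda>x. local_metric M \<kappa> x u w))"

definition tnorm :: "('m, 'e) riemannian \<Rightarrow> 'm \<Rightarrow> ('m, 'e) tvec \<Rightarrow> real" where
  "tnorm M p v = sqrt (metric M p v v)"

section \<open>Curves on the unit interval and the Riemannian distance\<close>

definition smooth_curve_on ::
    "('m::topological_space, 'e::euclidean_space) riemannian \<Rightarrow> real set \<Rightarrow> (real \<Rightarrow> 'm) \<Rightarrow> bool" where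
  "smooth_curve_on M S \<gamma> \<longleftrightarrow>
     continuous_on S \<gamma> \<and>
     (\<forall>\<kappa>\<in>atlas M. smooth_on (S \<inter> \<gamma> -` chart_dom \<kappa>) (chart_map \<kappa> \<circ> \<gamma>))"

definition piecewise_smooth_curve ::
    "('m::topological_space, 'e::euclidean_space) riemannian \<Rightarrow> (real \<Rightarrow> 'm) \<Rightarrow> bool" where
  "piecewise_smooth_curve M \<gamma> \<longleftrightarrow>
     continuous_on {0..1} \<gamma> \<and>
     (\<exists>P. finite P \<and>
        (\<forall>a b. 0 \<le> a \<and> a < b \<and> b \<le> 1 \<and> {a<..<b} \<inter> P = {} \<longrightarrow> smooth_curve_on M {a..b} \<gamma>))"

text \<open>One-sided derivatives are used at the end points 0 and 1.\<close>

definition velocity ::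
    "('m, 'e::euclidean_space) riemannian \<Rightarrow> (real \<Rightarrow> 'm) \<Rightarrow> real \<Rightarrow> ('m, 'e) tvec" where
  "velocity M \<gamma> t =
     (\<lambda>\<kappa>. if \<kappa> \<in> charts_at M (\<gamma> t)
          then vector_derivative (chart_map \<kappa> \<circ> \<gamma>) (at t within {0..1}) else 0)"

text \<open>For a piecewise smooth curve the velocity is unspecified at finitely many break points only,
  which does not affect the integral.\<close>

definition curve_length ::
    "('m, 'e::euclidean_space) riemannian \<Rightarrow> (real \<Rightarrow> 'm) \<Rightarrow> real" where
  "curve_length M \<gamma> = integral {0..1} (\<lambda>t. tnorm M (\<gamma> t) (velocity M \<gamma> t))"

text \<open>The value is meaningful only for points in the same connected component; this is the case
  wherever the distance is used below.\<close>

definition rdist ::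
    "('m::topological_space, 'e::euclidean_space) riemannian \<Rightarrow> 'm \<Rightarrow> 'm \<Rightarrow> real" where
  "rdist M x y =
     Inf {curve_length M \<gamma> | \<gamma>. piecewise_smooth_curve M \<gamma> \<and> \<gamma> 0 = x \<and> \<gamma> 1 = y}"

definition minimizing ::
    "('m::topological_space, 'e::euclidean_space) riemannian \<Rightarrow> (real \<Rightarrow> 'm) \<Rightarrow> bool" where
  "minimizing M \<gamma> \<longleftrightarrow>
     piecewise_smooth_curve M \<gamma> \<and> curve_length M \<gamma> = rdist M (\<gamma> 0) (\<gamma> 1)"

section \<open>Geodesics and the exponential map\<close>

text \<open>The Christoffel symbols of the Levi-Civita connection in a chart, as a bilinear map
  \<open>\<Gamma>\<^sup>k\<^sub>i\<^sub>j = g\<^sup>k\<^sup>l (\<partial>\<^sub>i g\<^sub>j\<^sub>l + \<partial>\<^sub>j g\<^sub>i\<^sub>l - \<partial>\<^sub>l g\<^sub>i\<^sub>j) / 2\<close>, where the inverse metric is expressed by solving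
  the linear system for the unique vector \<open>z\<close>.\<close>

definition christoffel ::
    "('m, 'e::euclidean_space) riemannian \<Rightarrow> ('m, 'e) chart \<Rightarrow> 'e \<Rightarrow> 'e \<Rightarrow> 'e \<Rightarrow> 'e" where
  "christoffel M \<kappa> x u v =
     (THE z. \<forall>w. local_metric M \<kappa> x z w =
        (frechet_derivative (\<lambda>y. local_metric M \<kappa> y v w) (at x) u
       + frechet_derivative (\<lambda>y. local_metric M \<kappa> y u w) (at x) v
       - frechet_derivative (\<lambda>y. local_metric M \<kappa> y u v) (at x) w) / 2)"

definition covariant_acceleration ::
    "('m, 'e::euclidean_space) riemannian \<Rightarrow> (real \<Rightarrow> 'm) \<Rightarrow> real \<Rightarrow> ('m, 'e) tvec" where
  "covariant_acceleration M \<gamma> t =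
     (\<lambda>\<kappa>. if \<kappa> \<in> charts_at M (\<gamma> t)
          then let x' = (\<lambda>s. vector_derivative (chart_map \<kappa> \<circ> \<gamma>) (at s within {0..1}))
               in vector_derivative x' (at t within {0..1})
                  + christoffel M \<kappa> (chart_map \<kappa> (\<gamma> t)) (x' t) (x' t)
          else 0)"

definition geodesic ::
    "('m::topological_space, 'e::euclidean_space) riemannian \<Rightarrow> (real \<Rightarrow> 'm) \<Rightarrow> bool" where
  "geodesic M \<gamma> \<longleftrightarrow>
     smooth_curve_on M {0..1} \<gamma> \<and> (\<forall>t\<in>{0..1}. covariant_acceleration M \<gamma> t = (\<lambda>_. 0))"

definition geodesic_in ::
    "('m::topological_space, 'e::euclidean_space) riemannian \<Rightarrow> 'm set \<Rightarrow> 'm \<Rightarrow> 'm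
      \<Rightarrow> (real \<Rightarrow> 'm) \<Rightarrow> bool" where
  "geodesic_in M C x y \<gamma> \<longleftrightarrow> geodesic M \<gamma> \<and> \<gamma> ` {0..1} \<subseteq> C \<and> \<gamma> 0 = x \<and> \<gamma> 1 = y"

definition exp_domain ::
    "('m::topological_space, 'e::euclidean_space) riemannian \<Rightarrow> 'm \<Rightarrow> ('m, 'e) tvec set" where
  "exp_domain M x =
     {v \<in> tangent_space M x. \<exists>\<gamma>. geodesic M \<gamma> \<and> \<gamma> 0 = x \<and> velocity M \<gamma> 0 = v}"

definition exp_map ::
    "('m::topological_space, 'e::euclidean_space) riemannian \<Rightarrow> 'm \<Rightarrow> ('m, 'e) tvec \<Rightarrow> 'm" where
  "exp_map M x v = (THE y. \<exists>\<gamma>. geodesic M \<gamma> \<and> \<gamma> 0 = x \<and> velocity M \<gamma> 0 = v \<and> \<gamma> 1 = y)"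

section \<open>Geodesic convexity and the inverse exponential map\<close>

definition geodesically_convex ::
    "('m::topological_space, 'e::euclidean_space) riemannian \<Rightarrow> 'm set \<Rightarrow> bool" where
  "geodesically_convex M C \<longleftrightarrow>
     closed C \<and> (\<forall>x\<in>C. \<forall>y\<in>C. \<exists>\<gamma>. geodesic_in M C x y \<gamma> \<and> minimizing M \<gamma>)"

definition uniquely_geodesic ::
    "('m::topological_space, 'e::euclidean_space) riemannian \<Rightarrow> 'm set \<Rightarrow> bool" where
  "uniquely_geodesic M C \<longleftrightarrow>
     (\<forall>x\<in>C. \<forall>y\<in>C. \<forall>\<gamma> \<gamma>'. geodesic_in M C x y \<gamma> \<and> geodesic_in M C x y \<gamma>'
        \<longrightarrow> (\<forall>t\<in>{0..1}. \<gamma> t = \<gamma>' t))"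

definition uniquely_geodesically_convex ::
    "('m::topological_space, 'e::euclidean_space) riemannian \<Rightarrow> 'm set \<Rightarrow> bool" where
  "uniquely_geodesically_convex M C \<longleftrightarrow> geodesically_convex M C \<and> uniquely_geodesic M C"

text \<open>The set \<open>C\<^sub>x\<close> that the exponential map at \<open>x\<close> sends bijectively onto \<open>C\<close>. The geodesic is
  required to stay in \<open>C\<close>, and not only to end there: otherwise injectivity fails, e.g. for
  \<open>C\<close> half a great circle of a sphere and \<open>x\<close> one of its end points. The requirement is automatic
  whenever \<open>C\<close> is geodesically convex and the map is injective without it.\<close>

definition log_range ::
    "('m::topological_space, 'e::euclidean_space) riemannian \<Rightarrow> 'm set \<Rightarrow> 'm
      \<Rightarrow> ('m, 'e) tvec set" where
  "log_range M C x =
     {v \<in> exp_domain M x. minimizing M (\<lambda>t. exp_map M x (tscale t v)) \<and> exp_map M x v \<in> C \<and>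
        (\<forall>t\<in>{0..1}. exp_map M x (tscale t v) \<in> C)}"

definition log_map ::
    "('m::topological_space, 'e::euclidean_space) riemannian \<Rightarrow> 'm set \<Rightarrow> 'm \<Rightarrow> 'm
      \<Rightarrow> ('m, 'e) tvec" where
  "log_map M C x = the_inv_into (log_range M C x) (exp_map M x)"

section \<open>Functions on a manifold\<close>

definition differentiable_at ::
    "('m, 'e::euclidean_space) riemannian \<Rightarrow> ('m \<Rightarrow> real) \<Rightarrow> 'm \<Rightarrow> bool" where
  "differentiable_at M f x \<longleftrightarrow>
     (\<forall>\<kappa>\<in>charts_at M x. (f \<circ> chart_inv \<kappa>) differentiable (at (chart_map \<kappa> x)))"

text \<open>The tangent vector representing the differential of \<open>f\<close>, the latter computed in any chart.\<close>

definition grad ::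
    "('m, 'e::euclidean_space) riemannian \<Rightarrow> ('m \<Rightarrow> real) \<Rightarrow> 'm \<Rightarrow> ('m, 'e) tvec" where
  "grad M f x =
     (THE w. w \<in> tangent_space M x \<and>
        (\<forall>u\<in>tangent_space M x. \<forall>\<kappa>\<in>charts_at M x.
           metric M x w u = frechet_derivative (f \<circ> chart_inv \<kappa>) (at (chart_map \<kappa> x)) (u \<kappa>)))"

definition geodesically_convex_fun ::
    "('m::topological_space, 'e::euclidean_space) riemannian \<Rightarrow> 'm set \<Rightarrow> ('m \<Rightarrow> real) \<Rightarrow> bool" where
  "geodesically_convex_fun M C f \<longleftrightarrow>
     (\<forall>x\<in>C. \<forall>y\<in>C. \<forall>\<gamma>. geodesic_in M C x y \<gamma> \<longrightarrow>
        (\<forall>t\<in>{0..1}. f (\<gamma> t) \<le> (1 - t) * f x + t * f y))"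

definition geodesically_smooth ::
    "('m::topological_space, 'e::euclidean_space) riemannian \<Rightarrow> 'm set \<Rightarrow> real \<Rightarrow> ('m \<Rightarrow> real)
      \<Rightarrow> bool" where
  "geodesically_smooth M C L f \<longleftrightarrow>
     (\<forall>x\<in>C. \<forall>y\<in>C.
        \<bar>f y - f x - metric M x (grad M f x) (log_map M C x y)\<bar> \<le> L / 2 * (rdist M x y)\<^sup>2)"

definition riemannian_scaling_inequality ::
    "('m::topological_space, 'e::euclidean_space) riemannian \<Rightarrow> 'm set \<Rightarrow> real \<Rightarrow> bool" where
  "riemannian_scaling_inequality M C \<alpha> \<longleftrightarrow>
     (\<forall>x\<in>C. \<forall>w\<in>tangent_space M x. \<forall>v.
        is_arg_max (\<lambda>z. metric M x w (log_map M C x z)) (\<lambda>z. z \<in> C) v \<longrightarrow>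
        metric M x w (log_map M C x v) \<ge> \<alpha> * tnorm M x w * (tnorm M x (log_map M C x v))\<^sup>2)"

section \<open>The Riemannian Frank-Wolfe algorithm\<close>

text \<open>\<open>xs\<close> is a possible sequence of iterates, for any admissible choice of the arg max and arg min.
  The minus sign on a tangent vector is the pointwise one.\<close>

definition riemannian_frank_wolfe ::
    "('m::topological_space, 'e::euclidean_space) riemannian \<Rightarrow> 'm set \<Rightarrow> real \<Rightarrow> ('m \<Rightarrow> real)
      \<Rightarrow> (nat \<Rightarrow> 'm) \<Rightarrow> bool" where
  "riemannian_frank_wolfe M C L f xs \<longleftrightarrow>
     xs 0 \<in> C \<and>
     (\<forall>t. \<exists>v s \<gamma>.
        is_arg_max (\<lambda>z. metric M (xs t) (- grad M f (xs t)) (log_map M C (xs t) z)) (\<lambda>z. z \<in> C) v \<and>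
        is_arg_min (\<lambda>r. r * metric M (xs t) (grad M f (xs t)) (log_map M C (xs t) v)
                        + r\<^sup>2 * (L / 2) * (rdist M (xs t) v)\<^sup>2) (\<lambda>r. r \<in> {0..1}) s \<and>
        geodesic_in M C (xs t) v \<gamma> \<and> xs (Suc t) = \<gamma> s)"

end

(* A Frank-Wolfe step minimises over [0,1] a quadratic upper model of f, whose coefficients are the
   linear decrease towards v and the squared distance. Convexity bounds the linear decrease from
   below by the optimality gap, the scaling inequality bounds it by a multiple of the squared distance,
   and evaluating the model at min 1 (alpha c / L) gives the contraction factor.

   The geometric input is that, for x and y in C, the inverse exponential map is the initial velocity of
   the unique geodesic from x to y in C, and that its norm is the distance. This needs two facts
   about the geodesic equation, both obtained in charts: the speed is constant, and a geodesic is
   determined by its initial point and velocity. That an initial piece of a minimizing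
   geodesic is again minimizing is never needed: some minimizing geodesic in C has the same
   end points, and it is this piece by uniqueness. *)

theory Submission
  imports Defs
begin

section \<open>Differentiation and Gronwall's inequality\<close>

text \<open>Curves live on the interval [0,1], with one-sided derivatives at its ends, and the
  Christoffel symbols, the exponential map, its inverse and the gradient are definite descriptions,
  so each must be shown well-defined before it can be used. A uniqueness theorem for the geodesic
  equation would ask for Lipschitz Christoffel symbols, hence for regularity of the inverse metric.
  This is avoided by keeping the equation with its index lowered,
  \<open>G a w = - koszul v v w\<close>, and by comparing two solutions through the positive
  definite form \<open>G\<close> itself. The passage from a single chart to the whole interval is an
  induction over a connected set, and the property carried along it is agreement of both position
  and velocity. The value \<open>min 1 (\<alpha> * c / L)\<close> is the largest step in [0,1] for
  which the scaling inequality guarantees that the quadratic term of the model uses up at most half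
  of the linear decrease; the other half yields the factor.\<close>

lemma frechet_derivative_cong_open:
  assumes "open S" "x \<in> S" "\<And>y. y \<in> S \<Longrightarrow> f y = g y"
  shows "frechet_derivative f (at x) = frechet_derivative g (at x)"
proof -
  \<comment> \<open>\<open>frechet_derivative\<close> is a choice among all derivatives. Both
    functions have the same ones, so the choices coincide, even at a point where there are
    none.\<close>
  have "(f has_derivative D) (at x) \<longleftrightarrow> (g has_derivative D) (at x)" for D
    using assms has_derivative_transform_within_open[of f D x UNIV S g]
      has_derivative_transform_within_open[of g D x UNIV S f] by auto
  then show ?thesis
    by (simp add: frechet_derivative_def)
qed

section \<open>Classes of continuous differentiability: restriction, locality, scaling of the
  argument\<close>

lemma Ck_on_subset: "Ck_on k S f \<Longrightarrow> T \<subseteq> S \<Longrightarrow> Ck_on k T f"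
  by (induction k arbitrary: f) (auto intro: continuous_on_subset)

lemma Ck_on_cong_open:
  assumes "open S" "\<And>y. y \<in> S \<Longrightarrow> f y = g y" "Ck_on k S f"
  shows "Ck_on k S g"
  using assms(2,3)
proof (induction k arbitrary: f g)
  case 0
  then show ?case by (simp cong: continuous_on_cong)
next
  case (Suc k)
  have "g differentiable at x" if "x \<in> S" for x
  proof -
    have "(f has_derivative frechet_derivative f (at x)) (at x)"
      using Suc.prems(2) that by (simp add: frechet_derivative_works)
    then show ?thesis
      using has_derivative_transform_within_open[OF _ assms(1) that, of f _ UNIV g] Suc.prems(1)
      unfolding differentiable_def by blast
  qed
  moreover have "Ck_on k S (\<lambda>x. frechet_derivative g (at x) u)" for u
  proof (rule Suc.IH)
    show "Ck_on k S (\<lambda>x. frechet_derivative f (at x) u)"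
      using Suc.prems by simp
    show "frechet_derivative f (at y) u = frechet_derivative g (at y) u" if "y \<in> S" for y
      using frechet_derivative_cong_open[OF assms(1) that, of f g] Suc.prems by simp
  qed
  ultimately show ?case by simp
qed

text \<open>Differentiability and the derivative at a point only see a neighbourhood. This allows
  for the extensions in \<open>smooth_on\<close>, which may vary from point to point.\<close>

lemma Ck_on_local:
  assumes "\<And>x. x \<in> S \<Longrightarrow> \<exists>U. open U \<and> x \<in> U \<and> Ck_on k U f"
  shows "Ck_on k S f"
  using assms
proof (induction k arbitrary: f)
  case 0
  show ?case
  proof (simp, rule continuous_at_imp_continuous_on, rule ballI)
    fix x assume "x \<in> S"
    then obtain U where "open U" "x \<in> U" "continuous_on U f"
      using 0 by auto
    then show "isCont f x"
      using continuous_on_eq_continuous_at by blast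
  qed
next
  case (Suc k)
  have "Ck_on k S (\<lambda>x. frechet_derivative f (at x) u)" for u
  proof (rule Suc.IH)
    fix x assume "x \<in> S"
    then obtain U where "open U" "x \<in> U" "Ck_on (Suc k) U f"
      using Suc.prems by blast
    then show "\<exists>U. open U \<and> x \<in> U \<and> Ck_on k U (\<lambda>x. frechet_derivative f (at x) u)"
      by (intro exI[of _ U]) simp
  qed
  moreover have "f differentiable at x" if x: "x \<in> S" for x
  proof -
    obtain U where "x \<in> U" "Ck_on (Suc k) U f"
      using Suc.prems[OF x] by blast
    then show ?thesis by simp
  qed
  ultimately show ?case by simp
qed

text \<open>On an open set an extension agrees with \<open>f\<close> near the point, so
  \<open>f\<close> inherits its derivatives. This opens transition maps and the metric in a chart to
  ordinary calculus.\<close>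

lemma smooth_on_imp_Ck_on:
  assumes "smooth_on S f" "open S"
  shows "Ck_on k S f"
proof (rule Ck_on_local)
  fix x assume "x \<in> S"
  then obtain U h where U: "open U" "x \<in> U" "\<forall>k. Ck_on k U h" "\<forall>y\<in>S \<inter> U. h y = f y"
    using assms(1) unfolding smooth_on_def by blast
  have "Ck_on k (S \<inter> U) f"
    by (rule Ck_on_cong_open[of _ h]) (use U assms(2) in \<open>auto intro: Ck_on_subset\<close>)
  then show "\<exists>U. open U \<and> x \<in> U \<and> Ck_on k U f"
    using U(1,2) \<open>x \<in> S\<close> assms(2) by (intro exI[of _ "S \<inter> U"]) auto
qed

lemma Ck_on_has_derivative:
  "Ck_on (Suc k) S f \<Longrightarrow> x \<in> S \<Longrightarrow> (f has_derivative frechet_derivative f (at x)) (at x)"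
  by (simp flip: frechet_derivative_works)

lemma Ck_on_SucD:
  assumes "Ck_on (Suc k) S f"
  shows "Ck_on k S f"
  using assms
proof (induction k arbitrary: f)
  case 0
  then show ?case
    by (auto intro!: continuous_at_imp_continuous_on differentiable_imp_continuous_within)
next
  case (Suc k)
  \<comment> \<open>A single unfolding leaves the derivative at order \<open>Suc k\<close>, the form
    that the induction hypothesis takes; \<open>simp\<close> would unfold both levels.\<close>
  have "Ck_on k S (\<lambda>x. frechet_derivative f (at x) u)" for u
    by (rule Suc.IH) (use Suc.prems in \<open>subst (asm) Ck_on.simps(2), blast\<close>)
  then show ?case
    using Suc.prems by (subst Ck_on.simps(2), subst (asm) Ck_on.simps(2)) blast
qed

text \<open>The factor moves into the direction of differentiation, so the induction hypothesis is
  applied to the derivative of \<open>h\<close> in the direction \<open>a * u\<close>. The value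
  \<open>a = 0\<close> is allowed; it occurs when a geodesic is shrunk to a constant curve.\<close>

lemma Ck_on_scale_arg:
  fixes h :: "real \<Rightarrow> 'b::euclidean_space"
  assumes "open U" "Ck_on k U h"
  shows "Ck_on k ((\<lambda>t. a * t) -` U) (\<lambda>t. h (a * t))"
  using assms(2)
proof (induction k arbitrary: h)
  case 0
  then show ?case
    by (auto intro!: continuous_on_compose2[of U h] continuous_intros)
next
  case (Suc k)
  have op: "open ((\<lambda>t. a * t) -` U)"
    by (rule open_vimage[OF assms(1)]) (intro continuous_intros)
  have D: "((\<lambda>t. h (a * t)) has_derivative (\<lambda>u. frechet_derivative h (at (a * t)) (a * u))) (at t)"
    if "a * t \<in> U" for t
    by (rule has_derivative_compose[where f="\<lambda>t. a * t" and g=h])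
       (auto intro!: derivative_eq_intros Ck_on_has_derivative[OF Suc.prems that])
  then have F: "frechet_derivative (\<lambda>t. h (a * t)) (at t) = (\<lambda>u. frechet_derivative h (at (a * t)) (a * u))"
    if "a * t \<in> U" for t
    using frechet_derivative_at that by metis
  have "Ck_on k ((\<lambda>t. a * t) -` U) (\<lambda>t. frechet_derivative (\<lambda>t. h (a * t)) (at t) u)" for u
    by (rule Ck_on_cong_open[OF op _ Suc.IH[of "\<lambda>x. frechet_derivative h (at x) (a * u)"]])
       (use F Suc.prems in auto)
  then show ?case
    using D by (auto simp: differentiable_def)
qed

text \<open>On the compact ball each partial derivative is bounded; the sum of these bounds over the
  basis bounds the operator norm, and the mean value inequality on a convex set applies.\<close>

lemma Ck_on_lipschitz:
  fixes f :: "'a::euclidean_space \<Rightarrow> 'b::euclidean_space"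
  assumes "Ck_on (Suc 0) S f" "cball x r \<subseteq> S"
  shows "\<exists>K. \<forall>y\<in>cball x r. \<forall>z\<in>cball x r. norm (f y - f z) \<le> K * norm (y - z)"
proof -
  let ?D = "\<lambda>y. frechet_derivative f (at y)"
  have "\<exists>N. \<forall>y\<in>cball x r. norm (?D y k) \<le> N" for k
  proof -
    have "continuous_on (cball x r) (\<lambda>y. ?D y k)"
      using assms by (auto intro: continuous_on_subset)
    then have "bounded ((\<lambda>y. ?D y k) ` cball x r)"
      by (simp add: compact_continuous_image compact_imp_bounded)
    then show ?thesis
      by (auto simp: bounded_iff)
  qed
  then obtain N where N: "\<And>k y. y \<in> cball x r \<Longrightarrow> norm (?D y k) \<le> N k"
    by metis
  have der: "(f has_derivative ?D y) (at y)" if "y \<in> cball x r" for y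
    using Ck_on_has_derivative[OF assms(1)] assms(2) that by blast
  have on: "onorm (?D y) \<le> (\<Sum>k\<in>Basis. N k)" if y: "y \<in> cball x r" for y
  proof (rule onorm_le)
    fix u
    have lin: "linear (?D y)"
      using der[OF y] has_derivative_linear by blast
    have "norm (?D y u) = norm (\<Sum>k\<in>Basis. (u \<bullet> k) *\<^sub>R ?D y k)"
      using linear_sum[OF lin, of "\<lambda>k. (u \<bullet> k) *\<^sub>R k" Basis]
      by (simp add: linear_scale[OF lin] euclidean_representation)
    also have "\<dots> \<le> (\<Sum>k\<in>Basis. norm u * N k)"
      by (rule order_trans[OF norm_sum], rule sum_mono)
         (auto intro!: mult_mono N[OF y] Basis_le_norm)
    finally show "norm (?D y u) \<le> (\<Sum>k\<in>Basis. N k) * norm u"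
      by (simp add: sum_distrib_left mult.commute)
  qed
  show ?thesis
    using differentiable_bound[OF convex_cball has_derivative_at_withinI[OF der] on] by blast
qed

text \<open>By Cauchy-Schwarz the derivative of \<open>y \<bullet> y\<close> is at most
  \<open>2 * K\<close> times \<open>y \<bullet> y\<close>, so the product with
  \<open>exp (- 2 * K * \<tau>)\<close> does not increase from its value 0 at
  \<open>s\<close>.\<close>

lemma gronwall_zero_forward:
  fixes y :: "real \<Rightarrow> 'a::real_inner"
  assumes "s \<le> t" and der: "\<And>\<tau>. \<tau> \<in> {s..t} \<Longrightarrow> (y has_vector_derivative y' \<tau>) (at \<tau>)"
    and le: "\<And>\<tau>. \<tau> \<in> {s..t} \<Longrightarrow> norm (y' \<tau>) \<le> K * norm (y \<tau>)"
    and "y s = 0"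
  shows "y t = 0"
proof -
  let ?e = "\<lambda>\<tau>. (y \<tau> \<bullet> y \<tau>) * exp (- 2 * K * \<tau>)"
  have "\<exists>d. (?e has_real_derivative d) (at \<tau>) \<and> d \<le> 0" if "s \<le> \<tau>" "\<tau> \<le> t" for \<tau>
  proof -
    have y: "(y has_derivative (\<lambda>h. h *\<^sub>R y' \<tau>)) (at \<tau>)"
      using der that by (simp add: has_vector_derivative_def)
    have d: "(?e has_real_derivative (2 * (y \<tau> \<bullet> y' \<tau>) - 2 * K * (y \<tau> \<bullet> y \<tau>)) * exp (- 2 * K * \<tau>)) (at \<tau>)"
      unfolding has_field_derivative_def
      by (rule derivative_eq_intros y refl)+
         (auto simp: fun_eq_iff algebra_simps inner_commute)
    have "y \<tau> \<bullet> y' \<tau> \<le> norm (y \<tau>) * norm (y' \<tau>)"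
      by (rule norm_cauchy_schwarz)
    also have "\<dots> \<le> norm (y \<tau>) * (K * norm (y \<tau>))"
      using le that by (intro mult_left_mono) auto
    also have "\<dots> = K * (y \<tau> \<bullet> y \<tau>)"
      by (simp add: dot_square_norm power2_eq_square)
    finally show ?thesis
      using d by (intro exI conjI) (auto intro!: mult_nonpos_nonneg)
  qed
  then have "?e t \<le> ?e s"
    by (rule DERIV_nonpos_imp_nonincreasing[OF assms(1)])
  then show ?thesis
    using \<open>y s = 0\<close> by (simp add: mult_le_0_iff flip: power2_norm_eq_inner)
qed

text \<open>Times before \<open>s\<close> are reached by reversing time, which changes only the sign
  of the derivative.\<close>

lemma gronwall_zero:
  fixes y :: "real \<Rightarrow> 'a::real_inner"
  assumes "is_interval J" and der: "\<And>\<tau>. \<tau> \<in> J \<Longrightarrow> (y has_vector_derivative y' \<tau>) (at \<tau>)"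
    and le: "\<And>\<tau>. \<tau> \<in> J \<Longrightarrow> norm (y' \<tau>) \<le> K * norm (y \<tau>)"
    and "s \<in> J" "t \<in> J" "y s = 0"
  shows "y t = 0"
proof (cases "s \<le> t")
  case True
  then have "{s..t} \<subseteq> J"
    using assms(4,5) interval_subset_is_interval[OF assms(1)] by (simp flip: box_real(2))
  then show ?thesis
    using gronwall_zero_forward[OF True, of y y' K] assms by blast
next
  case False
  have "{t..s} \<subseteq> J"
    using assms(4,5) interval_subset_is_interval[OF assms(1)] by (simp flip: box_real(2))
  then have J: "\<tau> \<in> {-s..-t} \<Longrightarrow> - \<tau> \<in> J" for \<tau>
    by auto
  have "((\<lambda>\<tau>. y (- \<tau>)) has_vector_derivative - y' (- \<tau>)) (at \<tau>)" if "\<tau> \<in> {-s..-t}" for \<tau>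
    using vector_diff_chain_at[OF has_vector_derivative_minus[OF has_vector_derivative_id]
        der[OF J[OF that]]] by (simp add: o_def)
  then show ?thesis
    using gronwall_zero_forward[of "-s" "-t" "\<lambda>\<tau>. y (- \<tau>)" "\<lambda>\<tau>. - y' (- \<tau>)" K] False J le assms(6)
    by simp
qed

text \<open>The map that sends \<open>z\<close> to the values \<open>b z k\<close> on the basis is
  injective by positive definiteness, hence onto by equality of dimensions. It serves twice, since
  the Christoffel symbol and the gradient are both described as such a \<open>z\<close>.\<close>

lemma bilinear_form_representation:
  fixes b :: "'a::euclidean_space \<Rightarrow> 'a \<Rightarrow> real"
  assumes "bilinear b" and pos: "\<And>u. u \<noteq> 0 \<Longrightarrow> 0 < b u u" and l: "linear l"
  shows "\<exists>!z. \<forall>w. b z w = l w"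
proof -
  have lin: "linear (\<lambda>z. b z w)" "linear (b z)" for z w
    using assms(1) by (auto simp: bilinear_def)
  let ?A = "\<lambda>z. \<Sum>k\<in>Basis. b z k *\<^sub>R k"
  have linA: "linear ?A"
    by (rule linearI) (simp_all add: linear_add[OF lin(1)] linear_scale[OF lin(1)]
        scaleR_add_left sum.distrib scaleR_right.sum)
  have eqI: "b z w = m w" if "linear m" "\<And>k. k \<in> Basis \<Longrightarrow> b z k = m k" for z w m
    using linear_eq_on_span[OF lin(2) that(1), of Basis z] that(2) by auto
  have "z = 0" if "?A z = 0" for z
  proof (rule ccontr)
    assume "z \<noteq> 0"
    have "b z k = 0" if "k \<in> Basis" for k
      using arg_cong[OF \<open>?A z = 0\<close>, of "\<lambda>y. y \<bullet> k"] that by (simp add: inner_sum_left_Basis)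
    then have "b z z = 0"
      using eqI[of "\<lambda>_. 0"] by (auto intro: linear_zero)
    then show False
      using pos[OF \<open>z \<noteq> 0\<close>] by simp
  qed
  then have "surj ?A"
    using linear_injective_imp_surjective[OF linA] linear_injective_0[OF linA] by blast
  then obtain z where z: "(\<Sum>k\<in>Basis. l k *\<^sub>R k) = ?A z"
    by (meson surjD)
  have "b z k = l k" if "k \<in> Basis" for k
    using arg_cong[OF z, of "\<lambda>y. y \<bullet> k"] that by (simp add: inner_sum_left_Basis)
  then have "\<forall>w. b z w = l w"
    using eqI[OF l] by blast
  moreover have "z' = z" if "\<forall>w. b z' w = l w" for z'
  proof (rule ccontr)
    assume "z' \<noteq> z"
    then show False
      using pos[of "z' - z"] that calculation linear_diff[OF lin(1)] by simp
  qed
  ultimately show ?thesis by blast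
qed

section \<open>The geodesic equation in a coordinate domain\<close>

text \<open>The metric seen in one chart, detached from the manifold. Order two makes the first
  derivatives of \<open>G\<close>, which enter the geodesic equation, locally Lipschitz.\<close>

locale coordinate_metric =
  fixes \<Omega> :: "'e::euclidean_space set" and G :: "'e \<Rightarrow> 'e \<Rightarrow> 'e \<Rightarrow> real"
  assumes open_dom: "open \<Omega>"
    and bilinear: "x \<in> \<Omega> \<Longrightarrow> bilinear (G x)"
    and sym: "x \<in> \<Omega> \<Longrightarrow> G x u w = G x w u"
    and pos: "x \<in> \<Omega> \<Longrightarrow> u \<noteq> 0 \<Longrightarrow> 0 < G x u u"
    and C2: "Ck_on (Suc (Suc 0)) \<Omega> (\<lambda>x. G x u w)"
begin

definition DG :: "'e \<Rightarrow> 'e \<Rightarrow> 'e \<Rightarrow> 'e \<Rightarrow> real" where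
  "DG x u w = frechet_derivative (\<lambda>y. G y u w) (at x)"

text \<open>The Christoffel symbols of the first kind, that is, the right side of the linear system
  behind \<open>christoffel\<close>. The last argument of \<open>DG\<close> is the direction of
  differentiation.\<close>

definition koszul :: "'e \<Rightarrow> 'e \<Rightarrow> 'e \<Rightarrow> 'e \<Rightarrow> real" where
  "koszul x u v w = (DG x v w u + DG x u w v - DG x u v w) / 2"

lemma linear_left: "x \<in> \<Omega> \<Longrightarrow> linear (\<lambda>u. G x u w)"
  and linear_right: "x \<in> \<Omega> \<Longrightarrow> linear (G x u)"
  using bilinear by (auto simp: bilinear_def)

text \<open>Regularity in \<open>x\<close> is given for fixed vectors only. The expansion separates
  the point from the vectors, so that both may move along a curve.\<close>

lemma expand:
  assumes "x \<in> \<Omega>"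
  shows "G x u w = (\<Sum>i\<in>Basis. \<Sum>j\<in>Basis. (u \<bullet> i) * (w \<bullet> j) * G x i j)"
proof -
  have "G x u w = (\<Sum>i\<in>Basis. (u \<bullet> i) * G x i w)"
    using linear_sum[OF linear_left[OF assms], of "\<lambda>i. (u \<bullet> i) *\<^sub>R i" Basis w]
    by (simp add: euclidean_representation linear_scale[OF linear_left[OF assms]])
  also have "\<dots> = (\<Sum>i\<in>Basis. (u \<bullet> i) * (\<Sum>j\<in>Basis. (w \<bullet> j) * G x i j))"
    using linear_sum[OF linear_right[OF assms], of _ "\<lambda>i. (w \<bullet> i) *\<^sub>R i" Basis]
    by (simp add: euclidean_representation linear_scale[OF linear_right[OF assms]])
  finally show ?thesis
    by (simp add: sum_distrib_left mult.assoc)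
qed

lemma has_derivative_DG:
  "x \<in> \<Omega> \<Longrightarrow> ((\<lambda>y. G y u w) has_derivative DG x u w) (at x)"
  unfolding DG_def using Ck_on_has_derivative[OF C2] .

lemma linear_DG: "x \<in> \<Omega> \<Longrightarrow> linear (DG x u w)"
  using has_derivative_DG has_derivative_linear by blast

text \<open>Differentiation commutes with the finite expansion of \<open>G\<close>, and derivatives
  are unique; hence \<open>DG\<close> is also linear in the vectors that are inserted into the
  metric.\<close>

lemma DG_expand2:
  assumes "x \<in> \<Omega>"
  shows "DG x u w z = (\<Sum>i\<in>Basis. \<Sum>j\<in>Basis. (u \<bullet> i) * (w \<bullet> j) * DG x i j z)"
proof -
  have "((\<lambda>y. \<Sum>i\<in>Basis. \<Sum>j\<in>Basis. (u \<bullet> i) * (w \<bullet> j) * G y i j) has_derivative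
      (\<lambda>z. \<Sum>i\<in>Basis. \<Sum>j\<in>Basis. (u \<bullet> i) * (w \<bullet> j) * DG x i j z)) (at x)"
    by (intro has_derivative_sum has_derivative_mult_right has_derivative_DG assms)
  then have "((\<lambda>y. G y u w) has_derivative
      (\<lambda>z. \<Sum>i\<in>Basis. \<Sum>j\<in>Basis. (u \<bullet> i) * (w \<bullet> j) * DG x i j z)) (at x)"
    by (rule has_derivative_transform_within_open[OF _ open_dom assms])
       (simp add: expand[of _ u w])
  from has_derivative_unique[OF has_derivative_DG[OF assms] this] show ?thesis
    by simp
qed

lemma DG_expand:
  assumes "x \<in> \<Omega>"
  shows "DG x u w z = (\<Sum>i\<in>Basis. \<Sum>j\<in>Basis. \<Sum>k\<in>Basis. (u \<bullet> i) * (w \<bullet> j) * ((z \<bullet> k) * DG x i j k))"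
proof -
  have *: "DG x i j z = (\<Sum>k\<in>Basis. (z \<bullet> k) * DG x i j k)" for i j
    using linear_sum[OF linear_DG[OF assms], of i j "\<lambda>i. (z \<bullet> i) *\<^sub>R i" Basis]
    by (simp add: euclidean_representation linear_scale[OF linear_DG[OF assms]])
  then show ?thesis
    by (subst DG_expand2[OF assms], subst *) (simp only: sum_distrib_left)
qed

lemma linear_koszul:
  assumes "x \<in> \<Omega>"
  shows "linear (koszul x u v)"
proof -
  have l: "linear (\<lambda>w. DG x a w b)" for a b
  proof (rule linearI)
    show "DG x a (w1 + w2) b = DG x a w1 b + DG x a w2 b" for w1 w2
      by (subst (1 2 3) DG_expand2[OF assms]) (simp add: inner_add_left algebra_simps sum.distrib)
    show "DG x a (r *\<^sub>R w) b = r *\<^sub>R DG x a w b" for r w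
      by (subst (1 2) DG_expand2[OF assms]) (simp add: sum_distrib_left mult_ac)
  qed
  show ?thesis
    by (rule linearI)
       (simp_all add: koszul_def linear_add[OF l] linear_scale[OF l] linear_add[OF linear_DG[OF assms]]
          linear_scale[OF linear_DG[OF assms]] field_simps)
qed

text \<open>Homogeneity of degree two in the velocity matches the factor \<open>r\<^sup>2\<close>
  that the acceleration receives when time is scaled by \<open>r\<close>.\<close>

lemma koszul_scale:
  assumes "x \<in> \<Omega>"
  shows "koszul x (r *\<^sub>R u) (r *\<^sub>R u) w = r\<^sup>2 * koszul x u u w"
proof -
  have "DG x (r *\<^sub>R u) w z = r * DG x u w z" "DG x u (r *\<^sub>R w) z = r * DG x u w z" for u w z
    by (simp_all add: DG_expand2[OF assms, of "r *\<^sub>R u" w] DG_expand2[OF assms, of u w]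
          DG_expand2[OF assms, of u "r *\<^sub>R w"] sum_distrib_left mult_ac)
  then show ?thesis
    by (simp add: koszul_def linear_scale[OF linear_DG[OF assms]] power2_eq_square algebra_simps)
qed

lemma ex1_christoffel: "x \<in> \<Omega> \<Longrightarrow> \<exists>!z. \<forall>w. G x z w = koszul x u v w"
  by (rule bilinear_form_representation[OF bilinear pos linear_koszul])

text \<open>The product rule gives \<open>2 * G (h t) a (v t) + DG (h t) (v t) (v t) (v t)\<close>.
  With all three vectors equal, \<open>koszul\<close> is half of the last term, so the equation
  tested with \<open>v t\<close> cancels it.\<close>

lemma energy_derivative:
  assumes h: "(h has_vector_derivative v t) (at t)" and v: "(v has_vector_derivative a) (at t)"
    and "h t \<in> \<Omega>" and geo: "\<And>w. G (h t) a w = - koszul (h t) (v t) (v t) w"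
  shows "((\<lambda>s. G (h s) (v s) (v s)) has_real_derivative 0) (at t)"
proof -
  let ?F = "\<lambda>s. \<Sum>i\<in>Basis. \<Sum>j\<in>Basis. (v s \<bullet> i) * (v s \<bullet> j) * G (h s) i j"
  have vi: "((\<lambda>s. v s \<bullet> i) has_real_derivative a \<bullet> i) (at t)" for i
    using v unfolding has_vector_derivative_def has_field_derivative_def
    by (auto intro!: derivative_eq_intros)
  have gi: "((\<lambda>s. G (h s) i j) has_real_derivative DG (h t) i j (v t)) (at t)" for i j
  proof -
    have "((\<lambda>s. G (h s) i j) has_derivative (\<lambda>r. DG (h t) i j (r *\<^sub>R v t))) (at t)"
      using has_derivative_compose[OF h[unfolded has_vector_derivative_def] has_derivative_DG[OF assms(3)]] .
    then show ?thesis
      by (simp add: has_field_derivative_def linear_scale[OF linear_DG[OF assms(3)]] mult.commute[of _ "DG (h t) i j (v t)"])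
  qed
  have "(?F has_real_derivative (\<Sum>i\<in>Basis. \<Sum>j\<in>Basis.
      ((a \<bullet> i) * (v t \<bullet> j) + (a \<bullet> j) * (v t \<bullet> i)) * G (h t) i j
        + DG (h t) i j (v t) * ((v t \<bullet> i) * (v t \<bullet> j)))) (at t)"
    by (intro DERIV_sum DERIV_mult vi gi)
  also have "(\<Sum>i\<in>Basis. \<Sum>j\<in>Basis.
      ((a \<bullet> i) * (v t \<bullet> j) + (a \<bullet> j) * (v t \<bullet> i)) * G (h t) i j
        + DG (h t) i j (v t) * ((v t \<bullet> i) * (v t \<bullet> j)))
      = G (h t) a (v t) + G (h t) (v t) a + DG (h t) (v t) (v t) (v t)"
    by (simp add: expand[OF assms(3), of a "v t"] expand[OF assms(3), of "v t" a]
          DG_expand2[OF assms(3), of "v t" "v t"] algebra_simps sum.distrib)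
  also have "\<dots> = 0"
    using sym[OF assms(3)] geo[of "v t"] by (simp add: koszul_def)
  finally have F: "(?F has_real_derivative 0) (at t)" .
  \<comment> \<open>The expansion holds only where the curve is inside the domain; by continuity
    this is so near \<open>t\<close>, which is enough for the derivative at
    \<open>t\<close>.\<close>
  have "\<forall>\<^sub>F s in nhds t. h s \<in> \<Omega>"
  proof -
    have "isCont h t"
      using h has_vector_derivative_continuous by blast
    then show ?thesis
      using open_dom assms(3) topological_tendstoD[of h "h t" "nhds t" \<Omega>]
      by (simp add: isCont_def tendsto_at_iff_tendsto_nhds)
  qed
  then have "\<forall>\<^sub>F s in nhds t. ?F s = G (h s) (v s) (v s)"
    by eventually_elim (rule expand[symmetric])
  from DERIV_cong_ev[OF refl this refl] F show ?thesis by blast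
qed

text \<open>The quadratic form attains a positive minimum on the compact product of the ball and the
  unit sphere, and homogeneity extends the bound to all vectors. This uniform bound takes the place
  of a bound on the inverse metric.\<close>

lemma coercive:
  assumes "cball x0 r \<subseteq> \<Omega>"
  shows "\<exists>l>0. \<forall>x\<in>cball x0 r. \<forall>u. l * (norm u)\<^sup>2 \<le> G x u u"
\<comment> \<open>A negative radius gives the empty ball, on which there is no minimum to
  take.\<close>
proof (cases "cball x0 r = {}")
  case True
  then show ?thesis by (intro exI[of _ 1]) auto
next
  case False
  let ?K = "cball x0 r \<times> sphere (0::'e) 1"
  have cont: "continuous_on ?K (\<lambda>p. G (fst p) i j)" for i j
  proof (rule continuous_on_compose2[of \<Omega> "\<lambda>x. G x i j"])
    show "continuous_on \<Omega> (\<lambda>x. G x i j)"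
      using Ck_on_SucD[OF Ck_on_SucD[OF C2]] by (simp only: Ck_on.simps(1))
  qed (use assms in \<open>auto intro: continuous_intros\<close>)
  have "continuous_on ?K (\<lambda>p. \<Sum>i\<in>Basis. \<Sum>j\<in>Basis. (snd p \<bullet> i) * (snd p \<bullet> j) * G (fst p) i j)"
    by (intro continuous_intros cont)
  then have "continuous_on ?K (\<lambda>p. G (fst p) (snd p) (snd p))"
  proof (rule continuous_on_eq)
    fix p assume "p \<in> ?K"
    then have "fst p \<in> \<Omega>" using assms by auto
    then show "(\<Sum>i\<in>Basis. \<Sum>j\<in>Basis. (snd p \<bullet> i) * (snd p \<bullet> j) * G (fst p) i j)
        = G (fst p) (snd p) (snd p)"
      by (rule expand[symmetric])
  qed
  moreover have "compact ?K"
    by (intro compact_Times) auto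
  moreover have "?K \<noteq> {}"
    using False by simp
  ultimately obtain p where p: "p \<in> ?K"
    "\<forall>q\<in>?K. G (fst p) (snd p) (snd p) \<le> G (fst q) (snd q) (snd q)"
    using continuous_attains_inf by blast
  let ?l = "G (fst p) (snd p) (snd p)"
  have "?l > 0"
    using p(1) assms by (intro pos) auto
  moreover have "?l * (norm u)\<^sup>2 \<le> G x u u" if x: "x \<in> cball x0 r" for x u
  proof (cases "u = 0")
    case True
    have "x \<in> \<Omega>" using assms x by blast
    then show ?thesis
      using True linear_0[OF linear_right] by auto
  next
    case False
    have "x \<in> \<Omega>" using assms x by blast
    let ?u = "(1 / norm u) *\<^sub>R u"
    have "?l \<le> G x ?u ?u"
      using p(2) x False by (force simp: dist_norm)
    also have "\<dots> = G x u u / (norm u)\<^sup>2"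
      by (simp add: linear_scale[OF linear_left[OF \<open>x \<in> \<Omega>\<close>]] linear_scale[OF linear_right[OF \<open>x \<in> \<Omega>\<close>]]
          power2_eq_square)
    finally show ?thesis
      using False by (simp add: field_simps)
  qed
  ultimately show ?thesis by blast
qed

end

section \<open>Lipschitz estimates along two curves\<close>

text \<open>Replaces local Lipschitz continuity of the Christoffel symbols: with \<open>e\<close> the distance between two
  curves in phase space, the terms of the geodesic equation along the curves are comparable, and
  the relation is stable under sums and products.\<close>

definition comparable_on :: "real set \<Rightarrow> (real \<Rightarrow> real) \<Rightarrow> (real \<Rightarrow> real) \<Rightarrow> (real \<Rightarrow> real) \<Rightarrow> bool" where
  "comparable_on J e p q \<longleftrightarrow>
     (\<exists>K. \<forall>t\<in>J. \<bar>p t\<bar> \<le> K \<and> \<bar>q t\<bar> \<le> K \<and> \<bar>p t - q t\<bar> \<le> K * e t)"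

lemma comparable_onI:
  assumes "\<And>t. t \<in> J \<Longrightarrow> 0 \<le> e t" "\<And>t. t \<in> J \<Longrightarrow> \<bar>p t\<bar> \<le> A"
    "\<And>t. t \<in> J \<Longrightarrow> \<bar>q t\<bar> \<le> B" "\<And>t. t \<in> J \<Longrightarrow> \<bar>p t - q t\<bar> \<le> D * e t"
  shows "comparable_on J e p q"
  unfolding comparable_on_def
proof (intro exI ballI conjI)
  fix t assume t: "t \<in> J"
  show "\<bar>p t\<bar> \<le> max A (max B D)" "\<bar>q t\<bar> \<le> max A (max B D)"
    using assms(2,3)[OF t] by auto
  show "\<bar>p t - q t\<bar> \<le> max A (max B D) * e t"
    by (rule order_trans[OF assms(4)[OF t] mult_right_mono]) (auto simp: assms(1)[OF t])
qed

lemma comparable_on_add: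
  assumes "comparable_on J e p q" "comparable_on J e p' q'"
  shows "comparable_on J e (\<lambda>t. p t + p' t) (\<lambda>t. q t + q' t)"
proof -
  obtain K K' where K: "\<And>t. t \<in> J \<Longrightarrow> \<bar>p t\<bar> \<le> K \<and> \<bar>q t\<bar> \<le> K \<and> \<bar>p t - q t\<bar> \<le> K * e t"
    "\<And>t. t \<in> J \<Longrightarrow> \<bar>p' t\<bar> \<le> K' \<and> \<bar>q' t\<bar> \<le> K' \<and> \<bar>p' t - q' t\<bar> \<le> K' * e t"
    using assms unfolding comparable_on_def by blast
  show ?thesis
    unfolding comparable_on_def
  proof (intro exI[of _ "K + K'"] ballI)
    fix t assume t: "t \<in> J"
    have "\<bar>p t - q t + (p' t - q' t)\<bar> \<le> K * e t + K' * e t"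
      using K(1)[OF t] K(2)[OF t] by (intro order_trans[OF abs_triangle_ineq add_mono]) auto
    moreover have "p t - q t + (p' t - q' t) = p t + p' t - (q t + q' t)"
      by simp
    ultimately show "\<bar>p t + p' t\<bar> \<le> K + K' \<and> \<bar>q t + q' t\<bar> \<le> K + K'
        \<and> \<bar>p t + p' t - (q t + q' t)\<bar> \<le> (K + K') * e t"
      unfolding distrib_right using K(1)[OF t] K(2)[OF t]
      by (metis (no_types, lifting) abs_triangle_ineq add_mono order_trans)
  qed
qed

text \<open>Splitting the difference as \<open>p * (p' - q') + (p - q) * q'\<close> shows why the
  relation asks for bounds on the functions besides the bound on their difference.\<close>

lemma comparable_on_mult:
  assumes "comparable_on J e p q" "comparable_on J e p' q'" "\<And>t. t \<in> J \<Longrightarrow> 0 \<le> e t"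
  shows "comparable_on J e (\<lambda>t. p t * p' t) (\<lambda>t. q t * q' t)"
proof -
  obtain K K' where K: "\<And>t. t \<in> J \<Longrightarrow> \<bar>p t\<bar> \<le> K \<and> \<bar>q t\<bar> \<le> K \<and> \<bar>p t - q t\<bar> \<le> K * e t"
    "\<And>t. t \<in> J \<Longrightarrow> \<bar>p' t\<bar> \<le> K' \<and> \<bar>q' t\<bar> \<le> K' \<and> \<bar>p' t - q' t\<bar> \<le> K' * e t"
    using assms unfolding comparable_on_def by blast
  show ?thesis
  proof (rule comparable_onI[OF assms(3)])
    fix t assume t: "t \<in> J"
    note k = K(1)[OF t] K(2)[OF t]
    show "\<bar>p t * p' t\<bar> \<le> K * K'" "\<bar>q t * q' t\<bar> \<le> K * K'"
      unfolding abs_mult using k by (auto intro!: mult_mono)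
    have "p t * p' t - q t * q' t = p t * (p' t - q' t) + (p t - q t) * q' t"
      by (simp add: algebra_simps)
    then have "\<bar>p t * p' t - q t * q' t\<bar> \<le> \<bar>p t\<bar> * \<bar>p' t - q' t\<bar> + \<bar>p t - q t\<bar> * \<bar>q' t\<bar>"
      by (metis abs_mult abs_triangle_ineq)
    also have "\<dots> \<le> K * (K' * e t) + (K * e t) * K'"
      using k by (intro add_mono mult_mono) auto
    finally show "\<bar>p t * p' t - q t * q' t\<bar> \<le> (2 * K * K') * e t"
      by (simp add: algebra_simps)
  qed
qed

lemma comparable_on_const: "(\<And>t. t \<in> J \<Longrightarrow> 0 \<le> e t) \<Longrightarrow> comparable_on J e (\<lambda>_. c) (\<lambda>_. c)"
  by (rule comparable_onI[where A="\<bar>c\<bar>" and B="\<bar>c\<bar>" and D=0]) auto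

lemma comparable_on_sum:
  assumes "finite I" "\<And>i. i \<in> I \<Longrightarrow> comparable_on J e (p i) (q i)" "\<And>t. t \<in> J \<Longrightarrow> 0 \<le> e t"
  shows "comparable_on J e (\<lambda>t. \<Sum>i\<in>I. p i t) (\<lambda>t. \<Sum>i\<in>I. q i t)"
  using assms(1,2)
  by (induction I rule: finite_induct) (auto intro!: comparable_on_add comparable_on_const assms(3))

lemma comparable_on_lipschitz:
  fixes f :: "'a::euclidean_space \<Rightarrow> real"
  assumes "Ck_on (Suc 0) S f" "cball x0 r \<subseteq> S"
    and x: "\<And>t. t \<in> J \<Longrightarrow> x t \<in> cball x0 r" "\<And>t. t \<in> J \<Longrightarrow> y t \<in> cball x0 r"
    and e: "\<And>t. t \<in> J \<Longrightarrow> norm (x t - y t) \<le> e t"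
  shows "comparable_on J e (\<lambda>t. f (x t)) (\<lambda>t. f (y t))"
proof -
  obtain K where K: "\<forall>y\<in>cball x0 r. \<forall>z\<in>cball x0 r. norm (f y - f z) \<le> K * norm (y - z)"
    using Ck_on_lipschitz[OF assms(1,2)] by blast
  have "continuous_on (cball x0 r) f"
    using Ck_on_SucD[OF assms(1)] assms(2) by (auto intro: continuous_on_subset)
  then have "bounded (f ` cball x0 r)"
    by (simp add: compact_continuous_image compact_imp_bounded)
  then obtain A where A: "\<And>y. y \<in> cball x0 r \<Longrightarrow> \<bar>f y\<bar> \<le> A"
    by (auto simp only: bounded_iff ball_simps real_norm_def)
  show ?thesis
  proof (rule comparable_onI)
    fix t assume t: "t \<in> J"
    show "0 \<le> e t"
      using e[OF t] norm_ge_zero order_trans by blast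
    show "\<bar>f (x t)\<bar> \<le> A" "\<bar>f (y t)\<bar> \<le> A"
      using A x t by auto
    have "\<bar>f (x t) - f (y t)\<bar> \<le> K * norm (x t - y t)"
      using K x t by auto
    \<comment> \<open>The sign of \<open>K\<close> is unknown, so the absolute value comes in before
      the distance is enlarged to \<open>e t\<close>.\<close>
    also have "\<dots> \<le> \<bar>K\<bar> * e t"
      using e[OF t] by (intro mult_mono) auto
    finally show "\<bar>f (x t) - f (y t)\<bar> \<le> \<bar>K\<bar> * e t" .
  qed
qed

lemma comparable_on_cong:
  assumes "comparable_on J e p q" "\<And>t. t \<in> J \<Longrightarrow> p' t = p t" "\<And>t. t \<in> J \<Longrightarrow> q' t = q t"
  shows "comparable_on J e p' q'"
  using assms unfolding comparable_on_def by fastforce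

section \<open>Uniqueness for the geodesic equation in one chart\<close>

context coordinate_metric
begin

text \<open>The geodesic equation with lowered index, free of Christoffel symbols. Derivatives are
  two-sided even at the ends of \<open>J\<close>, because the curves inserted later extend beyond
  \<open>J\<close>; the equation itself is demanded on \<open>J\<close> only.\<close>

definition solution_on :: "real set \<Rightarrow> 'e set \<Rightarrow> (real \<Rightarrow> 'e) \<Rightarrow> (real \<Rightarrow> 'e) \<Rightarrow> (real \<Rightarrow> 'e) \<Rightarrow> bool" where
  "solution_on J B h v a \<longleftrightarrow> continuous_on J a \<and>
     (\<forall>t\<in>J. h t \<in> B \<and> (h has_vector_derivative v t) (at t) \<and> (v has_vector_derivative a t) (at t) \<and>
        (\<forall>w. G (h t) (a t) w = - koszul (h t) (v t) (v t) w))"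

text \<open>Subtracting the two equations writes \<open>G (h1 t) (a1 t - a2 t)\<close> as the
  difference of the \<open>koszul\<close> terms plus the change of \<open>G\<close> applied to
  \<open>a2 t\<close> between the two base points. Both are of the order of the distance in phase
  space, and coercivity passes the bound to \<open>a1 t - a2 t\<close>.\<close>

lemma acceleration_difference_bound:
  assumes J: "compact J" and B: "cball x0 r \<subseteq> \<Omega>"
    and 1: "solution_on J (cball x0 r) h1 v1 a1" and 2: "solution_on J (cball x0 r) h2 v2 a2"
  shows "\<exists>K\<ge>0. \<forall>t\<in>J. norm (a1 t - a2 t) \<le> K * (norm (h1 t - h2 t) + norm (v1 t - v2 t))"
proof -
  define e where "e t = norm (h1 t - h2 t) + norm (v1 t - v2 t)" for t
  have e0: "0 \<le> e t" for t
    by (simp add: e_def)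
  have B1: "h1 t \<in> cball x0 r" "h2 t \<in> cball x0 r" if "t \<in> J" for t
    using that 1 2 by (auto simp: solution_on_def)
  have dom: "h1 t \<in> \<Omega>" "h2 t \<in> \<Omega>" if "t \<in> J" for t
    using B1[OF that] B by auto
  have bnd: "\<exists>A. \<forall>t\<in>J. norm (f t) \<le> A" if "continuous_on J f" for f :: "real \<Rightarrow> 'e"
  proof -
    have "bounded (f ` J)"
      using that J by (simp add: compact_continuous_image compact_imp_bounded)
    then show ?thesis
      by (simp add: bounded_iff)
  qed
  have contv: "continuous_on J v1" "continuous_on J v2"
    using 1 2 by (auto simp: solution_on_def intro!: continuous_at_imp_continuous_on has_vector_derivative_continuous)
  obtain A1 A2 A3 where A: "\<And>t. t \<in> J \<Longrightarrow> norm (v1 t) \<le> A1" "\<And>t. t \<in> J \<Longrightarrow> norm (v2 t) \<le> A2"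
    "\<And>t. t \<in> J \<Longrightarrow> norm (a2 t) \<le> A3"
    using bnd[OF contv(1)] bnd[OF contv(2)] bnd[of a2] 2 unfolding solution_on_def by metis
  have cv: "comparable_on J e (\<lambda>t. v1 t \<bullet> i) (\<lambda>t. v2 t \<bullet> i)" if "i \<in> Basis" for i
  proof (rule comparable_onI)
    fix t assume t: "t \<in> J"
    show "\<bar>v1 t \<bullet> i\<bar> \<le> A1" "\<bar>v2 t \<bullet> i\<bar> \<le> A2"
      using A(1,2)[OF t] Basis_le_norm[OF that] order_trans by blast+
    have "\<bar>v1 t \<bullet> i - v2 t \<bullet> i\<bar> \<le> norm (v1 t - v2 t)"
      using Basis_le_norm[OF that, of "v1 t - v2 t"] by (simp add: inner_diff_left)
    then show "\<bar>v1 t \<bullet> i - v2 t \<bullet> i\<bar> \<le> 1 * e t"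
      by (simp add: e_def add_increasing)
  qed (rule e0)
  \<comment> \<open>The same acceleration stands on both sides: in the term that this serves, only
    the base point of the metric changes.\<close>
  have ca: "comparable_on J e (\<lambda>t. a2 t \<bullet> i) (\<lambda>t. a2 t \<bullet> i)" if "i \<in> Basis" for i
  proof (rule comparable_onI)
    fix t assume t: "t \<in> J"
    show "\<bar>a2 t \<bullet> i\<bar> \<le> A3" "\<bar>a2 t \<bullet> i\<bar> \<le> A3"
      using A(3)[OF t] Basis_le_norm[OF that] order_trans by blast+
    show "\<bar>a2 t \<bullet> i - a2 t \<bullet> i\<bar> \<le> 0 * e t" by simp
  qed (rule e0)
  have C1: "Ck_on (Suc 0) \<Omega> (\<lambda>x. DG x i j k)" for i j k
    using C2[of i j] by (subst (asm) Ck_on.simps(2)) (simp only: DG_def)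
  have le_e: "norm (h1 t - h2 t) \<le> e t" for t
    by (simp add: e_def)
  have cg: "comparable_on J e (\<lambda>t. G (h1 t) i j) (\<lambda>t. G (h2 t) i j)" for i j
    by (rule comparable_on_lipschitz[OF Ck_on_SucD[OF C2] B B1 le_e])
  have cD: "comparable_on J e (\<lambda>t. DG (h1 t) i j k) (\<lambda>t. DG (h2 t) i j k)" for i j k
    by (rule comparable_on_lipschitz[OF C1 B B1 le_e])
  have cG: "comparable_on J e (\<lambda>t. G (h1 t) (a2 t) k) (\<lambda>t. G (h2 t) (a2 t) k)" for k
  proof (rule comparable_on_cong)
    show "comparable_on J e
        (\<lambda>t. \<Sum>i\<in>Basis. \<Sum>j\<in>Basis. (a2 t \<bullet> i) * (k \<bullet> j) * G (h1 t) i j)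
        (\<lambda>t. \<Sum>i\<in>Basis. \<Sum>j\<in>Basis. (a2 t \<bullet> i) * (k \<bullet> j) * G (h2 t) i j)"
      by (intro comparable_on_sum comparable_on_mult comparable_on_const ca cg e0 finite_Basis)
  qed (rule expand[OF dom(1)] expand[OF dom(2)], assumption)+
  have c1: "comparable_on J e (\<lambda>t. DG (h1 t) (v1 t) k (v1 t)) (\<lambda>t. DG (h2 t) (v2 t) k (v2 t))" for k
  proof (rule comparable_on_cong)
    show "comparable_on J e
        (\<lambda>t. \<Sum>i\<in>Basis. \<Sum>j\<in>Basis. \<Sum>l\<in>Basis. (v1 t \<bullet> i) * (k \<bullet> j) * ((v1 t \<bullet> l) * DG (h1 t) i j l))
        (\<lambda>t. \<Sum>i\<in>Basis. \<Sum>j\<in>Basis. \<Sum>l\<in>Basis. (v2 t \<bullet> i) * (k \<bullet> j) * ((v2 t \<bullet> l) * DG (h2 t) i j l))"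
      by (intro comparable_on_sum comparable_on_mult comparable_on_const cv cD e0 finite_Basis)
  qed (rule DG_expand[OF dom(1)] DG_expand[OF dom(2)], assumption)+
  have c2: "comparable_on J e (\<lambda>t. DG (h1 t) (v1 t) (v1 t) k) (\<lambda>t. DG (h2 t) (v2 t) (v2 t) k)" for k
  proof (rule comparable_on_cong)
    show "comparable_on J e
        (\<lambda>t. \<Sum>i\<in>Basis. \<Sum>j\<in>Basis. \<Sum>l\<in>Basis. (v1 t \<bullet> i) * (v1 t \<bullet> j) * ((k \<bullet> l) * DG (h1 t) i j l))
        (\<lambda>t. \<Sum>i\<in>Basis. \<Sum>j\<in>Basis. \<Sum>l\<in>Basis. (v2 t \<bullet> i) * (v2 t \<bullet> j) * ((k \<bullet> l) * DG (h2 t) i j l))"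
      by (intro comparable_on_sum comparable_on_mult comparable_on_const cv cD e0 finite_Basis)
  qed (rule DG_expand[OF dom(1)] DG_expand[OF dom(2)], assumption)+
  \<comment> \<open>For equal velocities the first two terms of \<open>koszul\<close> coincide,
    which leaves one full term and minus one half of another.\<close>
  have cK: "comparable_on J e (\<lambda>t. koszul (h1 t) (v1 t) (v1 t) k) (\<lambda>t. koszul (h2 t) (v2 t) (v2 t) k)" for k
  proof (rule comparable_on_cong)
    show "comparable_on J e
        (\<lambda>t. DG (h1 t) (v1 t) k (v1 t) + (- 1 / 2) * DG (h1 t) (v1 t) (v1 t) k)
        (\<lambda>t. DG (h2 t) (v2 t) k (v2 t) + (- 1 / 2) * DG (h2 t) (v2 t) (v2 t) k)"
      by (intro comparable_on_add comparable_on_mult comparable_on_const c1 c2 e0)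
  qed (simp_all add: koszul_def)
  have "\<exists>K. \<forall>t\<in>J. \<bar>G (h1 t) (a1 t - a2 t) k\<bar> \<le> K * e t" for k
  proof -
    obtain K K' where K:
      "\<forall>t\<in>J. \<bar>G (h1 t) (a2 t) k - G (h2 t) (a2 t) k\<bar> \<le> K * e t"
      "\<forall>t\<in>J. \<bar>koszul (h1 t) (v1 t) (v1 t) k - koszul (h2 t) (v2 t) (v2 t) k\<bar> \<le> K' * e t"
      using cG[of k] cK[of k] unfolding comparable_on_def by blast
    have "\<bar>G (h1 t) (a1 t - a2 t) k\<bar> \<le> (K + K') * e t" if t: "t \<in> J" for t
    proof -
      have "G (h1 t) (a1 t - a2 t) k = - koszul (h1 t) (v1 t) (v1 t) k - G (h1 t) (a2 t) k"
        using 1 t by (simp add: solution_on_def linear_diff[OF linear_left[OF dom(1)[OF t]]])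
      also have "\<dots> = - (koszul (h1 t) (v1 t) (v1 t) k - koszul (h2 t) (v2 t) (v2 t) k)
          - (G (h1 t) (a2 t) k - G (h2 t) (a2 t) k)"
        using 2 t by (simp add: solution_on_def)
      finally have "\<bar>G (h1 t) (a1 t - a2 t) k\<bar>
          \<le> \<bar>koszul (h1 t) (v1 t) (v1 t) k - koszul (h2 t) (v2 t) (v2 t) k\<bar>
            + \<bar>G (h1 t) (a2 t) k - G (h2 t) (a2 t) k\<bar>"
        by linarith
      with K t show ?thesis
        unfolding distrib_right by fastforce
    qed
    then show ?thesis by blast
  qed
  then obtain K where K: "\<And>k t. t \<in> J \<Longrightarrow> \<bar>G (h1 t) (a1 t - a2 t) k\<bar> \<le> K k * e t"
    by metis
  obtain l where l: "l > 0" "\<And>x u. x \<in> cball x0 r \<Longrightarrow> l * (norm u)\<^sup>2 \<le> G x u u"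
    using coercive[OF B] by blast
  define S where "S = (\<Sum>k\<in>Basis. \<bar>K k\<bar>)"
  have "norm (a1 t - a2 t) \<le> S / l * e t" if t: "t \<in> J" for t
  proof (cases "a1 t = a2 t")
    case True
    then show ?thesis
      using l(1) e0 by (auto simp: S_def intro!: mult_nonneg_nonneg divide_nonneg_pos sum_nonneg)
  next
    case False
    let ?b = "a1 t - a2 t"
    \<comment> \<open>The difference is paired with itself: coercivity bounds this below by a
      square, the basis expansion bounds it above by a first power, and one factor
      \<open>norm ?b\<close> cancels.\<close>
    have "l * (norm ?b)\<^sup>2 \<le> G (h1 t) ?b ?b"
      by (rule l(2)[OF B1(1)[OF t]])
    also have "\<dots> = (\<Sum>k\<in>Basis. (?b \<bullet> k) * G (h1 t) ?b k)"
      using linear_sum[OF linear_right[OF dom(1)[OF t]], of ?b "\<lambda>i. (?b \<bullet> i) *\<^sub>R i" Basis]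
      by (simp only: euclidean_representation linear_scale[OF linear_right[OF dom(1)[OF t]]] real_scaleR_def)
    also have "\<dots> \<le> (\<Sum>k\<in>Basis. norm ?b * (\<bar>K k\<bar> * e t))"
    proof (rule sum_mono)
      fix k :: 'e assume k: "k \<in> Basis"
      have "(?b \<bullet> k) * G (h1 t) ?b k \<le> \<bar>?b \<bullet> k\<bar> * \<bar>G (h1 t) ?b k\<bar>"
        by (metis abs_ge_self abs_mult)
      also have "\<dots> \<le> norm ?b * (\<bar>K k\<bar> * e t)"
      proof (rule mult_mono)
        have "K k * e t \<le> \<bar>K k\<bar> * e t"
          by (rule mult_right_mono) (auto simp: e0)
        then show "\<bar>G (h1 t) ?b k\<bar> \<le> \<bar>K k\<bar> * e t"
          using K[OF t, of k] by linarith
      qed (auto intro: Basis_le_norm[OF k])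
      finally show "(?b \<bullet> k) * G (h1 t) ?b k \<le> norm ?b * (\<bar>K k\<bar> * e t)" .
    qed
    also have "\<dots> = norm ?b * (S * e t)"
      by (simp add: S_def sum_distrib_left sum_distrib_right)
    finally have "norm ?b * (l * norm ?b) \<le> norm ?b * (S * e t)"
      by (simp add: power2_eq_square mult_ac)
    then have "l * norm ?b \<le> S * e t"
      using False by simp
    then show ?thesis
      using l(1) by (simp add: field_simps)
  qed
  then show ?thesis
    using l(1) unfolding e_def
    by (intro exI[of _ "S / l"] conjI ballI) (auto simp: S_def sum_nonneg)
qed

text \<open>In phase space the difference of the pairs (position, velocity) satisfies a first-order
  linear inequality, so it vanishes throughout if it vanishes once.\<close>

lemma solutions_agree:
  assumes J: "compact J" "is_interval J" and B: "cball x0 r \<subseteq> \<Omega>"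
    and 1: "solution_on J (cball x0 r) h1 v1 a1" and 2: "solution_on J (cball x0 r) h2 v2 a2"
    and "s \<in> J" "t \<in> J" "h1 s = h2 s" "v1 s = v2 s"
  shows "h1 t = h2 t \<and> v1 t = v2 t"
proof -
  obtain K where K: "K \<ge> 0"
    "\<And>t. t \<in> J \<Longrightarrow> norm (a1 t - a2 t) \<le> K * (norm (h1 t - h2 t) + norm (v1 t - v2 t))"
    using acceleration_difference_bound[OF J(1) B 1 2] by blast
  let ?y = "\<lambda>t. (h1 t - h2 t, v1 t - v2 t)"
  let ?y' = "\<lambda>t. (v1 t - v2 t, a1 t - a2 t)"
  have "?y t = 0"
  \<comment> \<open>The velocity part of \<open>?y'\<close> contributes 1 and the acceleration part
    contributes \<open>K\<close>, relative to the sum of the two norms; that sum is at most twice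
    the norm of the pair.\<close>
  proof (rule gronwall_zero[OF J(2), where y' = ?y' and K = "2 * (1 + K)"])
    fix \<tau> assume \<tau>: "\<tau> \<in> J"
    show "(?y has_vector_derivative ?y' \<tau>) (at \<tau>)"
      using 1 2 \<tau> unfolding solution_on_def by (intro derivative_intros) auto
    have le: "norm (h1 \<tau> - h2 \<tau>) + norm (v1 \<tau> - v2 \<tau>) \<le> 2 * norm (?y \<tau>)"
      using norm_fst_le[of "h1 \<tau> - h2 \<tau>" "v1 \<tau> - v2 \<tau>"] norm_snd_le[of "v1 \<tau> - v2 \<tau>" "h1 \<tau> - h2 \<tau>"]
      by linarith
    have "norm (?y' \<tau>) \<le> (1 + K) * (norm (h1 \<tau> - h2 \<tau>) + norm (v1 \<tau> - v2 \<tau>))"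
      using norm_Pair_le[of "v1 \<tau> - v2 \<tau>" "a1 \<tau> - a2 \<tau>"] K(2)[OF \<tau>] norm_ge_zero[of "h1 \<tau> - h2 \<tau>"]
      unfolding distrib_right mult_1 by linarith
    also have "\<dots> \<le> (1 + K) * (2 * norm (?y \<tau>))"
      using K(1) by (intro mult_left_mono le) simp
    finally show "norm (?y' \<tau>) \<le> 2 * (1 + K) * norm (?y \<tau>)"
      by (simp only: mult_ac)
  qed (use assms in \<open>auto simp: zero_prod_def\<close>)
  then show ?thesis
    by (simp add: prod_eq_iff)
qed

end

section \<open>Tangent vectors and charts\<close>

lemma has_vector_derivative_cong_within_open:
  assumes "(f has_vector_derivative D) (at t within S)" "open U" "t \<in> U" "t \<in> S"
    and "\<And>y. y \<in> U \<Longrightarrow> y \<in> S \<Longrightarrow> f y = g y"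
  shows "(g has_vector_derivative D) (at t within S)"
proof -
  obtain d where "0 < d" "ball t d \<subseteq> U"
    using assms(2,3) openE by blast
  then show ?thesis
    using assms(1,4,5)
    by (intro has_vector_derivative_transform_within[of f D t S d g])
       (auto simp: subset_iff dist_commute)
qed

lemma vector_derivative_cong_within:
  assumes "t \<in> S" "\<And>y. y \<in> S \<Longrightarrow> f y = g y"
  shows "vector_derivative f (at t within S) = vector_derivative g (at t within S)"
proof -
  have "(f has_vector_derivative D) (at t within S) \<longleftrightarrow> (g has_vector_derivative D) (at t within S)" for D
    using has_vector_derivative_cong_within_open[of f D t S UNIV g]
      has_vector_derivative_cong_within_open[of g D t S UNIV f] assms by auto
  then show ?thesis
    by (simp add: vector_derivative_def)
qed

lemma Ck_on_has_vector_derivative: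
  assumes "Ck_on (Suc k) U f" "s \<in> U"
  shows "(f has_vector_derivative frechet_derivative f (at s) 1) (at s)"
proof -
  have D: "(f has_derivative frechet_derivative f (at s)) (at s)"
    by (rule Ck_on_has_derivative[OF assms])
  have eq: "frechet_derivative f (at s) r = r *\<^sub>R frechet_derivative f (at s) 1" for r
    using linear_scale[OF has_derivative_linear[OF D], of r 1] by simp
  show ?thesis
    unfolding has_vector_derivative_def by (rule has_derivative_eq_rhs[OF D]) (rule ext, rule eq)
qed

section \<open>Tangent spaces and the metric in coordinates\<close>

locale riemannian_space =
  fixes M :: "('m::{t2_space,second_countable_topology}, 'e::euclidean_space) riemannian"
  assumes riemannian: "riemannian_manifold M"
begin

lemma smooth_atlas: "smooth_atlas (atlas M)"
  using riemannian by (simp add: riemannian_manifold_def)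

lemma charts_atD: "\<kappa> \<in> charts_at M p \<Longrightarrow> \<kappa> \<in> atlas M" "\<kappa> \<in> charts_at M p \<Longrightarrow> p \<in> chart_dom \<kappa>"
  by (auto simp: charts_at_def)

lemma ex_chart: "\<exists>\<kappa>. \<kappa> \<in> charts_at M p"
  using smooth_atlas unfolding smooth_atlas_def charts_at_def by blast

lemma open_chart_dom: "\<kappa> \<in> atlas M \<Longrightarrow> open (chart_dom \<kappa>)"
  and open_chart_image: "\<kappa> \<in> atlas M \<Longrightarrow> open (chart_map \<kappa> ` chart_dom \<kappa>)"
  and chart_homeomorphism: "\<kappa> \<in> atlas M \<Longrightarrow>
    homeomorphism (chart_dom \<kappa>) (chart_map \<kappa> ` chart_dom \<kappa>) (chart_map \<kappa>) (chart_inv \<kappa>)"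
  using smooth_atlas unfolding smooth_atlas_def by blast+

lemma chart_inv_chart_map: "\<kappa> \<in> atlas M \<Longrightarrow> p \<in> chart_dom \<kappa> \<Longrightarrow> chart_inv \<kappa> (chart_map \<kappa> p) = p"
  using chart_homeomorphism unfolding homeomorphism_def by blast

lemma open_overlap:
  assumes "\<kappa> \<in> atlas M" "\<kappa>' \<in> atlas M"
  shows "open (chart_map \<kappa> ` (chart_dom \<kappa> \<inter> chart_dom \<kappa>'))"
  by (rule openin_open_trans[OF homeomorphism_imp_open_map[OF chart_homeomorphism[OF assms(1)]]
        open_chart_image[OF assms(1)]])
     (simp add: openin_open_Int open_chart_dom[OF assms(2)])

lemma transition_has_derivative:
  assumes "\<kappa> \<in> charts_at M p" "\<kappa>' \<in> charts_at M p"
  shows "((chart_map \<kappa>' \<circ> chart_inv \<kappa>) has_derivative transition_deriv \<kappa> \<kappa>' p) (at (chart_map \<kappa> p))"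
proof -
  have "smooth_on (chart_map \<kappa> ` (chart_dom \<kappa> \<inter> chart_dom \<kappa>')) (chart_map \<kappa>' \<circ> chart_inv \<kappa>)"
    using smooth_atlas charts_atD assms unfolding smooth_atlas_def by blast
  note smooth_on_imp_Ck_on[OF this open_overlap[OF charts_atD(1)[OF assms(1)] charts_atD(1)[OF assms(2)]], of "Suc 0"]
  then show ?thesis
    unfolding transition_deriv_def
    by (rule Ck_on_has_derivative) (use charts_atD assms in blast)
qed

lemma linear_transition:
  "\<kappa> \<in> charts_at M p \<Longrightarrow> \<kappa>' \<in> charts_at M p \<Longrightarrow> linear (transition_deriv \<kappa> \<kappa>' p)"
  using transition_has_derivative has_derivative_linear by blast

text \<open>The chain rule on the overlap of the first two charts. It is the compatibility that puts
  \<open>coord_vec\<close> into \<open>tangent_space\<close>.\<close>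

lemma transition_comp:
  assumes 1: "\<kappa>1 \<in> charts_at M p" and 2: "\<kappa>2 \<in> charts_at M p" and 3: "\<kappa>3 \<in> charts_at M p"
  shows "transition_deriv \<kappa>2 \<kappa>3 p (transition_deriv \<kappa>1 \<kappa>2 p u) = transition_deriv \<kappa>1 \<kappa>3 p u"
proof -
  note inv = chart_inv_chart_map[OF charts_atD[OF 1]]
  have "((chart_map \<kappa>3 \<circ> chart_inv \<kappa>2) has_derivative transition_deriv \<kappa>2 \<kappa>3 p)
      (at ((chart_map \<kappa>2 \<circ> chart_inv \<kappa>1) (chart_map \<kappa>1 p)))"
    using transition_has_derivative[OF 2 3] by (simp add: inv)
  from diff_chain_at[OF transition_has_derivative[OF 1 2] this]
  have "((chart_map \<kappa>3 \<circ> chart_inv \<kappa>1) has_derivative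
      (transition_deriv \<kappa>2 \<kappa>3 p \<circ> transition_deriv \<kappa>1 \<kappa>2 p)) (at (chart_map \<kappa>1 p))"
  proof (rule has_derivative_transform_within_open[OF _ open_overlap[OF charts_atD(1)[OF 1] charts_atD(1)[OF 2]]])
    show "chart_map \<kappa>1 p \<in> chart_map \<kappa>1 ` (chart_dom \<kappa>1 \<inter> chart_dom \<kappa>2)"
      using charts_atD 1 2 by blast
  qed (auto simp: chart_inv_chart_map[OF charts_atD(1)[OF 1]] chart_inv_chart_map[OF charts_atD(1)[OF 2]])
  from has_derivative_unique[OF this transition_has_derivative[OF 1 3]] show ?thesis
    by (simp add: fun_eq_iff)
qed

lemma transition_self:
  assumes "\<kappa> \<in> charts_at M p"
  shows "transition_deriv \<kappa> \<kappa> p u = u"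
proof -
  have "((chart_map \<kappa> \<circ> chart_inv \<kappa>) has_derivative (\<lambda>u. u)) (at (chart_map \<kappa> p))"
  proof (rule has_derivative_transform_within_open[OF has_derivative_ident open_chart_image])
    show "x = (chart_map \<kappa> \<circ> chart_inv \<kappa>) x" if "x \<in> chart_map \<kappa> ` chart_dom \<kappa>" for x
      using that chart_inv_chart_map[OF charts_atD(1)[OF assms]] by auto
  qed (use charts_atD[OF assms] in auto)
  from has_derivative_unique[OF transition_has_derivative[OF assms assms] this] show ?thesis
    by simp
qed

lemma coord_vec_in_tangent_space:
  "\<kappa> \<in> charts_at M p \<Longrightarrow> coord_vec M \<kappa> p u \<in> tangent_space M p"
  by (simp add: tangent_space_def coord_vec_def transition_comp)

lemma coord_vec_self: "\<kappa> \<in> charts_at M p \<Longrightarrow> coord_vec M \<kappa> p u \<kappa> = u"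
  by (simp add: coord_vec_def transition_self)

text \<open>Together with \<open>coord_vec_self\<close> this identifies the tangent space with the
  model space through any one chart, so equality of tangent vectors may be tested there.\<close>

lemma coord_vec_coords:
  assumes "v \<in> tangent_space M p" "\<kappa> \<in> charts_at M p"
  shows "coord_vec M \<kappa> p (v \<kappa>) = v"
proof
  fix \<kappa>'
  show "coord_vec M \<kappa> p (v \<kappa>) \<kappa>' = v \<kappa>'"
  proof (cases "\<kappa>' \<in> charts_at M p")
    case True
    then have "v \<kappa>' = transition_deriv \<kappa> \<kappa>' p (v \<kappa>)"
      using assms unfolding tangent_space_def by blast
    then show ?thesis
      using True by (simp add: coord_vec_def)
  next
    case False
    then have "v \<kappa>' = 0"
      using assms unfolding tangent_space_def by blast
    then show ?thesis
      using False by (simp add: coord_vec_def)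
  qed
qed

lemma tangent_space_eqI:
  "u \<in> tangent_space M p \<Longrightarrow> v \<in> tangent_space M p \<Longrightarrow> \<kappa> \<in> charts_at M p \<Longrightarrow> u \<kappa> = v \<kappa> \<Longrightarrow> u = v"
  by (metis coord_vec_coords)

lemma coord_vec_add:
  "\<kappa> \<in> charts_at M p \<Longrightarrow> coord_vec M \<kappa> p (u + w) = tadd (coord_vec M \<kappa> p u) (coord_vec M \<kappa> p w)"
  by (auto simp: coord_vec_def tadd_def fun_eq_iff linear_add[OF linear_transition])

lemma coord_vec_scale:
  "\<kappa> \<in> charts_at M p \<Longrightarrow> coord_vec M \<kappa> p (r *\<^sub>R u) = tscale r (coord_vec M \<kappa> p u)"
  by (auto simp: coord_vec_def tscale_def fun_eq_iff linear_scale[OF linear_transition])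

lemma tscale_in_tangent_space:
  assumes "u \<in> tangent_space M p"
  shows "tscale r u \<in> tangent_space M p"
proof -
  obtain \<kappa> where \<kappa>: "\<kappa> \<in> charts_at M p"
    using ex_chart by blast
  then have "tscale r u = coord_vec M \<kappa> p (r *\<^sub>R u \<kappa>)"
    using coord_vec_coords[OF assms] by (simp add: coord_vec_scale)
  then show ?thesis
    using coord_vec_in_tangent_space[OF \<kappa>] by simp
qed

lemma metric_sym: "u \<in> tangent_space M p \<Longrightarrow> v \<in> tangent_space M p \<Longrightarrow> metric M p u v = metric M p v u"
  and metric_add: "u \<in> tangent_space M p \<Longrightarrow> v \<in> tangent_space M p \<Longrightarrow> w \<in> tangent_space M p \<Longrightarrow>
    metric M p (tadd u v) w = metric M p u w + metric M p v w"
  and metric_scale: "u \<in> tangent_space M p \<Longrightarrow> v \<in> tangent_space M p \<Longrightarrow>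
    metric M p (tscale r u) v = r * metric M p u v"
  and metric_pos: "u \<in> tangent_space M p \<Longrightarrow> u \<noteq> (\<lambda>_. 0) \<Longrightarrow> 0 < metric M p u u"
  using riemannian by (simp_all add: riemannian_manifold_def)

lemma metric_scale_right:
  "u \<in> tangent_space M p \<Longrightarrow> v \<in> tangent_space M p \<Longrightarrow> metric M p u (tscale r v) = r * metric M p u v"
  by (metis metric_scale metric_sym tscale_in_tangent_space)

lemma tnorm_scale: "u \<in> tangent_space M p \<Longrightarrow> tnorm M p (tscale r u) = \<bar>r\<bar> * tnorm M p u"
  by (simp add: tnorm_def metric_scale metric_scale_right tscale_in_tangent_space real_sqrt_mult
      flip: mult.assoc)

lemma local_metric_chart_map:
  assumes "\<kappa> \<in> charts_at M p"
  shows "local_metric M \<kappa> (chart_map \<kappa> p) u w = metric M p (coord_vec M \<kappa> p u) (coord_vec M \<kappa> p w)"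
  using charts_atD[OF assms] by (simp add: local_metric_def chart_inv_chart_map)

lemma metric_eq_local_metric:
  assumes "\<kappa> \<in> charts_at M p" "u \<in> tangent_space M p" "w \<in> tangent_space M p"
  shows "metric M p u w = local_metric M \<kappa> (chart_map \<kappa> p) (u \<kappa>) (w \<kappa>)"
  using assms by (simp add: local_metric_chart_map coord_vec_coords)

lemma coordinate_metric:
  assumes \<kappa>: "\<kappa> \<in> atlas M"
  shows "coordinate_metric (chart_map \<kappa> ` chart_dom \<kappa>) (local_metric M \<kappa>)"
proof
  show "open (chart_map \<kappa> ` chart_dom \<kappa>)"
    by (rule open_chart_image[OF \<kappa>])
  show "Ck_on (Suc (Suc 0)) (chart_map \<kappa> ` chart_dom \<kappa>) (\<lambda>x. local_metric M \<kappa> x u w)" for u w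
    using riemannian \<kappa>
    by (intro smooth_on_imp_Ck_on open_chart_image) (auto simp: riemannian_manifold_def)
  fix x assume "x \<in> chart_map \<kappa> ` chart_dom \<kappa>"
  then obtain p where p: "x = chart_map \<kappa> p" "\<kappa> \<in> charts_at M p"
    using \<kappa> by (auto simp: charts_at_def)
  note t = coord_vec_in_tangent_space[OF p(2)]
  show sym: "local_metric M \<kappa> x u w = local_metric M \<kappa> x w u" for u w
    unfolding p local_metric_chart_map[OF p(2)] by (rule metric_sym[OF t t])
  show "0 < local_metric M \<kappa> x u u" if "u \<noteq> 0" for u
    unfolding p local_metric_chart_map[OF p(2)]
  proof (rule metric_pos[OF t])
    show "coord_vec M \<kappa> p u \<noteq> (\<lambda>_. 0)"
      using coord_vec_self[OF p(2), of u] that by auto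
  qed
  have lin: "linear (\<lambda>u. local_metric M \<kappa> x u w)" for w
    unfolding p local_metric_chart_map[OF p(2)]
    by (rule linearI) (simp_all add: coord_vec_add[OF p(2)] coord_vec_scale[OF p(2)] metric_add metric_scale t)
  moreover have "local_metric M \<kappa> x u = (\<lambda>w. local_metric M \<kappa> x w u)" for u
    using sym by blast
  ultimately show "bilinear (local_metric M \<kappa> x)"
    unfolding bilinear_def by metis
qed

section \<open>The geodesic equation and the lifting of curves in charts\<close>

abbreviation local_koszul :: "('m, 'e) chart \<Rightarrow> 'e \<Rightarrow> 'e \<Rightarrow> 'e \<Rightarrow> 'e \<Rightarrow> real" where
  "local_koszul \<kappa> \<equiv> coordinate_metric.koszul (local_metric M \<kappa>)"

text \<open>The linear system in the definition of \<open>christoffel\<close> has exactly one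
  solution at points of the chart image, so the definite description satisfies it.\<close>

lemma local_metric_christoffel:
  assumes "\<kappa> \<in> charts_at M p"
  shows "local_metric M \<kappa> (chart_map \<kappa> p) (christoffel M \<kappa> (chart_map \<kappa> p) u v) w
    = local_koszul \<kappa> (chart_map \<kappa> p) u v w"
proof -
  interpret coordinate_metric "chart_map \<kappa> ` chart_dom \<kappa>" "local_metric M \<kappa>"
    using coordinate_metric charts_atD assms by blast
  have "chart_map \<kappa> p \<in> chart_map \<kappa> ` chart_dom \<kappa>"
    using charts_atD[OF assms] by blast
  from theI'[OF ex1_christoffel[OF this, of u v]] show ?thesis
    unfolding christoffel_def koszul_def DG_def by blast
qed

text \<open>By positive definiteness a vector vanishes once its pairing with every \<open>w\<close>
  does. This trades the Christoffel symbol for its lowered form.\<close>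

lemma acceleration_iff:
  assumes "\<kappa> \<in> charts_at M p"
  shows "a + christoffel M \<kappa> (chart_map \<kappa> p) v v = 0 \<longleftrightarrow>
    (\<forall>w. local_metric M \<kappa> (chart_map \<kappa> p) a w = - local_koszul \<kappa> (chart_map \<kappa> p) v v w)"
proof -
  interpret coordinate_metric "chart_map \<kappa> ` chart_dom \<kappa>" "local_metric M \<kappa>"
    using coordinate_metric charts_atD assms by blast
  let ?x = "chart_map \<kappa> p"
  have x: "?x \<in> chart_map \<kappa> ` chart_dom \<kappa>"
    using charts_atD[OF assms] by blast
  have "(\<forall>w. local_metric M \<kappa> ?x a w = - local_koszul \<kappa> ?x v v w) \<longleftrightarrow>
      (\<forall>w. local_metric M \<kappa> ?x (a + christoffel M \<kappa> ?x v v) w = 0)"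
    using linear_add[OF linear_left[OF x], of a "christoffel M \<kappa> ?x v v"]
    by (simp add: local_metric_christoffel[OF assms] eq_neg_iff_add_eq_0)
  also have "\<dots> \<longleftrightarrow> a + christoffel M \<kappa> ?x v v = 0"
    using pos[OF x] linear_0[OF linear_left[OF x]] by (metis less_irrefl)
  finally show ?thesis by blast
qed

text \<open>A smooth curve on a closed interval extends locally to an open set of times. The
  extension \<open>h\<close> has two-sided derivatives \<open>v\<close> and \<open>a\<close>, and on
  [0,1] these recover the one-sided velocity and acceleration. Outside [0,1] nothing relates
  \<open>h\<close> to the curve.\<close>

definition chart_lift ::
    "(real \<Rightarrow> 'm) \<Rightarrow> ('m, 'e) chart \<Rightarrow> real set \<Rightarrow> (real \<Rightarrow> 'e) \<Rightarrow> (real \<Rightarrow> 'e) \<Rightarrow> (real \<Rightarrow> 'e) \<Rightarrow> bool" where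
  "chart_lift \<gamma> \<kappa> U h v a \<longleftrightarrow> open U \<and> continuous_on U a \<and>
     (\<forall>s\<in>U. (h has_vector_derivative v s) (at s) \<and> (v has_vector_derivative a s) (at s)) \<and>
     (\<forall>s\<in>U \<inter> {0..1}. \<kappa> \<in> charts_at M (\<gamma> s) \<and> chart_map \<kappa> (\<gamma> s) = h s \<and> velocity M \<gamma> s \<kappa> = v s \<and>
        covariant_acceleration M \<gamma> s \<kappa> = a s + christoffel M \<kappa> (h s) (v s) (v s))"

lemma chart_liftD:
  assumes "chart_lift \<gamma> \<kappa> U h v a"
  shows "open U" "continuous_on U a"
    "s \<in> U \<Longrightarrow> (h has_vector_derivative v s) (at s)"
    "s \<in> U \<Longrightarrow> (v has_vector_derivative a s) (at s)"
    "s \<in> U \<Longrightarrow> s \<in> {0..1} \<Longrightarrow> \<kappa> \<in> charts_at M (\<gamma> s)"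
    "s \<in> U \<Longrightarrow> s \<in> {0..1} \<Longrightarrow> chart_map \<kappa> (\<gamma> s) = h s"
    "s \<in> U \<Longrightarrow> s \<in> {0..1} \<Longrightarrow> velocity M \<gamma> s \<kappa> = v s"
    "s \<in> U \<Longrightarrow> s \<in> {0..1} \<Longrightarrow> covariant_acceleration M \<gamma> s \<kappa> = a s + christoffel M \<kappa> (h s) (v s) (v s)"
  using assms unfolding chart_lift_def by blast+

text \<open>At a point of a nondegenerate interval the derivative within the interval is unique, so
  it equals the derivative of any differentiable extension.\<close>

lemma chart_liftI:
  assumes "open U" "continuous_on U a"
    and h: "\<And>s. s \<in> U \<Longrightarrow> (h has_vector_derivative v s) (at s)"
    and v: "\<And>s. s \<in> U \<Longrightarrow> (v has_vector_derivative a s) (at s)"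
    and charts: "\<And>s. s \<in> U \<Longrightarrow> s \<in> {0..1} \<Longrightarrow> \<kappa> \<in> charts_at M (\<gamma> s)"
    and hx: "\<And>s. s \<in> U \<Longrightarrow> s \<in> {0..1} \<Longrightarrow> h s = chart_map \<kappa> (\<gamma> s)"
  shows "chart_lift \<gamma> \<kappa> U h v a"
proof -
  let ?x = "chart_map \<kappa> \<circ> \<gamma>"
  let ?x' = "\<lambda>s. vector_derivative ?x (at s within {0..1})"
  have x: "h s = ?x s" if "s \<in> U" "s \<in> {0..1}" for s
    using hx[OF that] by simp
  have x': "?x' s = v s" if "s \<in> U" "s \<in> {0..1}" for s
    by (rule vector_derivative_within_closed_interval[OF zero_less_one that(2)],
        rule has_vector_derivative_cong_within_open[OF has_vector_derivative_at_within[OF h[OF that(1)]]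
          assms(1) that x])
  \<comment> \<open>The same argument one order higher: near \<open>s\<close> in [0,1] the one-sided
    derivative \<open>?x'\<close> is itself extended by \<open>v\<close>.\<close>
  have x'': "vector_derivative ?x' (at s within {0..1}) = a s" if "s \<in> U" "s \<in> {0..1}" for s
    by (rule vector_derivative_within_closed_interval[OF zero_less_one that(2)],
        rule has_vector_derivative_cong_within_open[OF has_vector_derivative_at_within[OF v[OF that(1)]]
          assms(1) that x'[symmetric]])
  have "velocity M \<gamma> s \<kappa> = v s" if "s \<in> U" "s \<in> {0..1}" for s
    using x'[OF that] charts[OF that] by (simp add: velocity_def)
  moreover have "covariant_acceleration M \<gamma> s \<kappa> = a s + christoffel M \<kappa> (h s) (v s) (v s)"
    if "s \<in> U" "s \<in> {0..1}" for s
    using x'[OF that] x''[OF that] charts[OF that] hx[OF that]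
    by (simp add: covariant_acceleration_def Let_def)
  ultimately show ?thesis
    using assms unfolding chart_lift_def by simp
qed

lemma smooth_curve_chart:
  assumes \<gamma>: "smooth_curve_on M {0..1} \<gamma>" and t: "t \<in> {0..1}" and \<kappa>: "\<kappa> \<in> charts_at M (\<gamma> t)"
  shows "\<exists>U h v a. chart_lift \<gamma> \<kappa> U h v a \<and> t \<in> U"
proof -
  have atl: "\<kappa> \<in> atlas M" and dom: "\<gamma> t \<in> chart_dom \<kappa>"
    using charts_atD[OF \<kappa>] by auto
  have "smooth_on ({0..1} \<inter> \<gamma> -` chart_dom \<kappa>) (chart_map \<kappa> \<circ> \<gamma>)" and cont: "continuous_on {0..1} \<gamma>"
    using \<gamma> atl by (auto simp: smooth_curve_on_def)
  then obtain U1 h where U1: "open U1" "t \<in> U1" and h: "\<And>k. Ck_on k U1 h"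
    "\<forall>y\<in>{0..1} \<inter> \<gamma> -` chart_dom \<kappa> \<inter> U1. h y = (chart_map \<kappa> \<circ> \<gamma>) y"
    using t dom unfolding smooth_on_def by blast
  \<comment> \<open>Continuity yields an open set of times whose trace on [0,1] is where the curve
    is inside the chart; intersecting with it keeps the lift there.\<close>
  obtain V where V: "open V" "V \<inter> {0..1} = \<gamma> -` chart_dom \<kappa> \<inter> {0..1}"
    using cont open_chart_dom[OF atl] unfolding continuous_on_open_invariant by blast
  define U where "U = U1 \<inter> V"
  define v where "v s = frechet_derivative h (at s) 1" for s
  define a where "a s = frechet_derivative v (at s) 1" for s
  have U: "open U" "t \<in> U"
    using U1 V t dom unfolding U_def by blast+
  have CU: "Ck_on (Suc (Suc 0)) U h"
    by (rule Ck_on_subset[OF h(1)]) (simp add: U_def)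
  then have Cv: "Ck_on (Suc 0) U v"
    unfolding v_def by (subst (asm) Ck_on.simps(2)) blast
  have "chart_lift \<gamma> \<kappa> U h v a"
  proof (rule chart_liftI[OF U(1)])
    show "continuous_on U a"
      using Cv unfolding a_def by (subst (asm) Ck_on.simps(2)) simp
    show "(h has_vector_derivative v s) (at s)" if "s \<in> U" for s
      unfolding v_def by (rule Ck_on_has_vector_derivative[OF CU that])
    show "(v has_vector_derivative a s) (at s)" if "s \<in> U" for s
      unfolding a_def by (rule Ck_on_has_vector_derivative[OF Cv that])
    fix s assume s: "s \<in> U" "s \<in> {0..1}"
    have dom: "\<gamma> s \<in> chart_dom \<kappa>"
      using s V(2) unfolding U_def by blast
    then show "\<kappa> \<in> charts_at M (\<gamma> s)"
      using atl by (simp add: charts_at_def)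
    have "h s = (chart_map \<kappa> \<circ> \<gamma>) s"
      using s dom h(2) unfolding U_def by blast
    then show "h s = chart_map \<kappa> (\<gamma> s)"
      by simp
  qed
  then show ?thesis
    using U(2) by blast
qed

text \<open>Near \<open>t\<close> in [0,1] the curve in a second chart is the transition map after
  the lift in the first one, so the chain rule yields the transformation law.\<close>

lemma velocity_in_tangent_space:
  assumes \<gamma>: "smooth_curve_on M {0..1} \<gamma>" and t: "t \<in> {0..1}"
  shows "velocity M \<gamma> t \<in> tangent_space M (\<gamma> t)"
proof -
  have "velocity M \<gamma> t \<kappa>' = transition_deriv \<kappa> \<kappa>' (\<gamma> t) (velocity M \<gamma> t \<kappa>)"
    if \<kappa>: "\<kappa> \<in> charts_at M (\<gamma> t)" and \<kappa>': "\<kappa>' \<in> charts_at M (\<gamma> t)" for \<kappa> \<kappa>'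
  proof -
    obtain U h v a where l: "chart_lift \<gamma> \<kappa> U h v a" and tU: "t \<in> U"
      using smooth_curve_chart[OF \<gamma> t \<kappa>] by blast
    note c = chart_liftD[OF l]
    have "((chart_map \<kappa>' \<circ> chart_inv \<kappa> \<circ> h) has_vector_derivative transition_deriv \<kappa> \<kappa>' (\<gamma> t) (v t))
        (at t within {0..1})"
      unfolding has_vector_derivative_def o_def
      using has_derivative_compose[OF c(3)[OF tU, unfolded has_vector_derivative_def, THEN has_derivative_at_withinI]
          transition_has_derivative[OF \<kappa> \<kappa>', unfolded c(6)[OF tU t]]]
      by (simp add: o_def linear_scale[OF linear_transition[OF \<kappa> \<kappa>']])
    then have "((chart_map \<kappa>' \<circ> \<gamma>) has_vector_derivative transition_deriv \<kappa> \<kappa>' (\<gamma> t) (v t))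
        (at t within {0..1})"
    proof (rule has_vector_derivative_cong_within_open[OF _ c(1) tU t])
      fix s assume s: "s \<in> U" "s \<in> {0..1}"
      show "(chart_map \<kappa>' \<circ> chart_inv \<kappa> \<circ> h) s = (chart_map \<kappa>' \<circ> \<gamma>) s"
        using chart_inv_chart_map[OF charts_atD[OF c(5)[OF s]]] by (simp flip: c(6)[OF s])
    qed
    then show ?thesis
      using vector_derivative_within_closed_interval[of 0 1 t] t \<kappa>' c(7)[OF tU t]
      by (simp add: velocity_def)
  qed
  moreover have "velocity M \<gamma> t \<kappa> = 0" if "\<kappa> \<notin> charts_at M (\<gamma> t)" for \<kappa>
    using that by (simp add: velocity_def)
  ultimately show ?thesis
    unfolding tangent_space_def by blast
qed

end

section \<open>Geodesics and the inverse exponential map\<close>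

lemma smooth_on_cong:
  assumes "smooth_on S f" "\<And>y. y \<in> S \<Longrightarrow> f y = g y"
  shows "smooth_on S g"
  using assms unfolding smooth_on_def by (metis IntE)

lemma velocity_cong:
  fixes M :: "('m, 'e::euclidean_space) riemannian"
  assumes "t \<in> {0..1}" "\<And>s. s \<in> {0..1} \<Longrightarrow> \<gamma> s = \<gamma>' s"
  shows "velocity M \<gamma> t = velocity M \<gamma>' t"
proof
  fix \<kappa> :: "('m, 'e) chart"
  have "vector_derivative (chart_map \<kappa> \<circ> \<gamma>) (at t within {0..1})
      = vector_derivative (chart_map \<kappa> \<circ> \<gamma>') (at t within {0..1})"
    by (rule vector_derivative_cong_within) (use assms in auto)
  then show "velocity M \<gamma> t \<kappa> = velocity M \<gamma>' t \<kappa>"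
    using assms by (simp add: velocity_def)
qed

lemma smooth_curve_on_cong:
  assumes \<gamma>: "smooth_curve_on M S \<gamma>" and eq: "\<And>s. s \<in> S \<Longrightarrow> \<gamma> s = \<gamma>' s"
  shows "smooth_curve_on M S \<gamma>'"
  unfolding smooth_curve_on_def
proof (intro conjI ballI)
  show "continuous_on S \<gamma>'"
    using \<gamma> eq unfolding smooth_curve_on_def by (auto intro: continuous_on_eq)
  fix \<kappa> assume "\<kappa> \<in> atlas M"
  then have "smooth_on (S \<inter> \<gamma> -` chart_dom \<kappa>) (chart_map \<kappa> \<circ> \<gamma>)"
    using \<gamma> by (simp add: smooth_curve_on_def)
  moreover have "S \<inter> \<gamma> -` chart_dom \<kappa> = S \<inter> \<gamma>' -` chart_dom \<kappa>"
    using eq by auto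
  ultimately show "smooth_on (S \<inter> \<gamma>' -` chart_dom \<kappa>) (chart_map \<kappa> \<circ> \<gamma>')"
    using eq by (auto intro: smooth_on_cong)
qed

text \<open>Curves are functions on the whole real line, whereas uniqueness and the exponential map
  fix them on [0,1] only.\<close>

lemma minimizing_cong:
  assumes \<gamma>: "minimizing M \<gamma>" and eq: "\<And>s. s \<in> {0..1} \<Longrightarrow> \<gamma> s = \<gamma>' s"
  shows "minimizing M \<gamma>'"
proof -
  have "curve_length M \<gamma> = curve_length M \<gamma>'"
    unfolding curve_length_def
  proof (rule integral_cong)
    fix t :: real assume t: "t \<in> {0..1}"
    have "velocity M \<gamma> t = velocity M \<gamma>' t"
      by (rule velocity_cong[OF t eq])
    then show "tnorm M (\<gamma> t) (velocity M \<gamma> t) = tnorm M (\<gamma>' t) (velocity M \<gamma>' t)"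
      using eq[OF t] by simp
  qed
  moreover have "piecewise_smooth_curve M \<gamma>'"
  proof -
    obtain P where P: "finite P"
      "\<And>a b. 0 \<le> a \<and> a < b \<and> b \<le> 1 \<and> {a<..<b} \<inter> P = {} \<Longrightarrow> smooth_curve_on M {a..b} \<gamma>"
      and cont: "continuous_on {0..1} \<gamma>"
      using \<gamma> unfolding minimizing_def piecewise_smooth_curve_def by blast
    have "smooth_curve_on M {a..b} \<gamma>'" if "0 \<le> a \<and> a < b \<and> b \<le> 1 \<and> {a<..<b} \<inter> P = {}" for a b
      by (rule smooth_curve_on_cong[OF P(2)[OF that]]) (use that eq in auto)
    moreover have "continuous_on {0..1} \<gamma>'"
      using cont eq by (rule continuous_on_eq)
    ultimately show ?thesis
      using P(1) unfolding piecewise_smooth_curve_def by blast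
  qed
  ultimately show ?thesis
    using \<gamma> eq[of 0] eq[of 1] by (simp add: minimizing_def)
qed

section \<open>Constant speed, time scaling and uniqueness of geodesics\<close>

context riemannian_space
begin

lemma geodesic_smooth: "geodesic M \<gamma> \<Longrightarrow> smooth_curve_on M {0..1} \<gamma>"
  by (simp add: geodesic_def)

lemma geodesic_lift_equation:
  assumes "geodesic M \<gamma>" "chart_lift \<gamma> \<kappa> U h v a" "s \<in> U" "s \<in> {0..1}"
  shows "local_metric M \<kappa> (h s) (a s) w = - local_koszul \<kappa> (h s) (v s) (v s) w"
proof -
  note l = chart_liftD[OF assms(2)]
  have "a s + christoffel M \<kappa> (h s) (v s) (v s) = 0"
    using assms(1) l(8)[OF assms(3,4)] assms(4) by (simp add: geodesic_def)
  then show ?thesis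
    using acceleration_iff[OF l(5)[OF assms(3,4)]] l(6)[OF assms(3,4)] by simp
qed

text \<open>The squared speed does not depend on a chart, so its derivative may be computed in a
  chart chosen anew at each time, and no chain of charts along the curve has to be built.\<close>

lemma geodesic_speed_constant:
  assumes \<gamma>: "geodesic M \<gamma>" and t: "t \<in> {0..1}"
  shows "tnorm M (\<gamma> t) (velocity M \<gamma> t) = tnorm M (\<gamma> 0) (velocity M \<gamma> 0)"
proof -
  let ?E = "\<lambda>t. metric M (\<gamma> t) (velocity M \<gamma> t) (velocity M \<gamma> t)"
  have "(?E has_vector_derivative 0) (at s within {0..1})" if s: "s \<in> {0..1}" for s
  proof -
    obtain \<kappa> where \<kappa>: "\<kappa> \<in> charts_at M (\<gamma> s)"
      using ex_chart by blast
    obtain U h v a where l: "chart_lift \<gamma> \<kappa> U h v a" and sU: "s \<in> U"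
      using smooth_curve_chart[OF geodesic_smooth[OF \<gamma>] s \<kappa>] by blast
    note c = chart_liftD[OF l]
    interpret coordinate_metric "chart_map \<kappa> ` chart_dom \<kappa>" "local_metric M \<kappa>"
      using coordinate_metric charts_atD(1)[OF \<kappa>] by blast
    have "((\<lambda>s. local_metric M \<kappa> (h s) (v s) (v s)) has_real_derivative 0) (at s)"
    proof (rule energy_derivative[OF c(3)[OF sU] c(4)[OF sU]])
      show "h s \<in> chart_map \<kappa> ` chart_dom \<kappa>"
        using charts_atD(2)[OF \<kappa>] c(6)[OF sU s] by (metis imageI)
    qed (rule geodesic_lift_equation[OF \<gamma> l sU s])
    then have "((\<lambda>s. local_metric M \<kappa> (h s) (v s) (v s)) has_vector_derivative 0) (at s within {0..1})"
      by (simp add: has_real_derivative_iff_has_vector_derivative has_vector_derivative_at_within)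
    then show ?thesis
    proof (rule has_vector_derivative_cong_within_open[OF _ c(1) sU s])
      fix y assume y: "y \<in> U" "y \<in> {0..1}"
      show "local_metric M \<kappa> (h y) (v y) (v y) = ?E y"
        using velocity_in_tangent_space[OF geodesic_smooth[OF \<gamma>] y(2)] c(6,7)[OF y]
        by (simp add: metric_eq_local_metric[OF c(5)[OF y]])
    qed
  qed
  from has_vector_derivative_zero_constant[OF _ this] obtain e where "\<And>s. s \<in> {0..1} \<Longrightarrow> ?E s = e"
    by auto
  then show ?thesis
    using t by (simp add: tnorm_def)
qed

lemma geodesic_length:
  assumes "geodesic M \<gamma>"
  shows "curve_length M \<gamma> = tnorm M (\<gamma> 0) (velocity M \<gamma> 0)"
proof -
  have "curve_length M \<gamma> = integral {0..1} (\<lambda>t::real. tnorm M (\<gamma> 0) (velocity M \<gamma> 0))"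
    unfolding curve_length_def by (rule integral_cong) (rule geodesic_speed_constant[OF assms])
  then show ?thesis by simp
qed

lemma chart_lift_rescale:
  assumes l: "chart_lift \<gamma> \<kappa> U h v a" and r: "r \<in> {0..1}"
  shows "chart_lift (\<lambda>t. \<gamma> (r * t)) \<kappa> ((\<lambda>t. r * t) -` U)
    (\<lambda>t. h (r * t)) (\<lambda>t. r *\<^sub>R v (r * t)) (\<lambda>t. r\<^sup>2 *\<^sub>R a (r * t))"
proof (rule chart_liftI)
  note c = chart_liftD[OF l]
  have lin: "((\<lambda>t. r * t) has_vector_derivative r) (at s)" for s
    using has_vector_derivative_mult_right[OF has_vector_derivative_id, of r] by simp
  have r01: "r * s \<in> {0..1}" if "s \<in> {0..1}" for s
    using r that by (auto intro: mult_le_one)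
  show "open ((\<lambda>t. r * t) -` U)"
    by (rule open_vimage[OF c(1)]) (intro continuous_intros)
  show "continuous_on ((\<lambda>t. r * t) -` U) (\<lambda>t. r\<^sup>2 *\<^sub>R a (r * t))"
    by (intro continuous_intros continuous_on_compose2[OF c(2)]) auto
  fix s assume "s \<in> (\<lambda>t. r * t) -` U"
  then have s: "r * s \<in> U" by simp
  show "((\<lambda>t. h (r * t)) has_vector_derivative r *\<^sub>R v (r * s)) (at s)"
    using vector_diff_chain_at[OF lin c(3)[OF s]] by (simp add: o_def)
  show "((\<lambda>t. r *\<^sub>R v (r * t)) has_vector_derivative r\<^sup>2 *\<^sub>R a (r * s)) (at s)"
    using bounded_linear.has_vector_derivative[OF bounded_linear_scaleR_right
        vector_diff_chain_at[OF lin c(4)[OF s]], of r]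
    by (simp add: o_def power2_eq_square)
  assume "s \<in> {0..1}"
  from c(5)[OF s r01[OF this]] c(6)[OF s r01[OF this]]
  show "\<kappa> \<in> charts_at M (\<gamma> (r * s))" "h (r * s) = chart_map \<kappa> (\<gamma> (r * s))"
    by simp_all
qed

text \<open>Supplies the curves that realise \<open>exp_map\<close> at multiples of a vector, and
  the pieces of a geodesic from its start to an intermediate point.\<close>

lemma geodesic_rescale:
  assumes \<gamma>: "geodesic M \<gamma>" and r: "r \<in> {0..1}"
  shows "geodesic M (\<lambda>t. \<gamma> (r * t))"
    and "t \<in> {0..1} \<Longrightarrow> velocity M (\<lambda>t. \<gamma> (r * t)) t = tscale r (velocity M \<gamma> (r * t))"
proof -
  let ?\<gamma> = "\<lambda>t. \<gamma> (r * t)"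
  have r01: "r * s \<in> {0..1}" if "s \<in> {0..1}" for s
    using r that by (auto intro: mult_le_one)
  have lift: "velocity M ?\<gamma> s \<kappa> = r *\<^sub>R velocity M \<gamma> (r * s) \<kappa> \<and> covariant_acceleration M ?\<gamma> s \<kappa> = 0"
    if s: "s \<in> {0..1}" for s \<kappa>
  proof (cases "\<kappa> \<in> charts_at M (\<gamma> (r * s))")
    case False
    then show ?thesis
      by (simp add: velocity_def covariant_acceleration_def)
  next
    case \<kappa>: True
    obtain U h v a where l: "chart_lift \<gamma> \<kappa> U h v a" and sU: "r * s \<in> U"
      using smooth_curve_chart[OF geodesic_smooth[OF \<gamma>] r01[OF s] \<kappa>] by blast
    note c = chart_liftD[OF l]
    note c' = chart_liftD[OF chart_lift_rescale[OF l r]]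
    have sU': "s \<in> (\<lambda>t. r * t) -` U"
      using sU by simp
    interpret coordinate_metric "chart_map \<kappa> ` chart_dom \<kappa>" "local_metric M \<kappa>"
      using coordinate_metric charts_atD(1)[OF \<kappa>] by blast
    have dom: "h (r * s) \<in> chart_map \<kappa> ` chart_dom \<kappa>"
      using charts_atD(2)[OF \<kappa>] c(6)[OF sU r01[OF s]] by (metis imageI)
    \<comment> \<open>Both sides of the lowered equation at time \<open>r * s\<close> are multiplied
      by the square of \<open>r\<close>.\<close>
    have "r\<^sup>2 *\<^sub>R a (r * s) + christoffel M \<kappa> (h (r * s)) (r *\<^sub>R v (r * s)) (r *\<^sub>R v (r * s)) = 0"
      using acceleration_iff[OF \<kappa>, unfolded c(6)[OF sU r01[OF s]]]
      by (simp add: koszul_scale[OF dom] linear_scale[OF linear_left[OF dom]]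
          geodesic_lift_equation[OF \<gamma> l sU r01[OF s]])
    then show ?thesis
      using c'(7,8)[OF sU' s] c(7)[OF sU r01[OF s]] by simp
  qed
  show "velocity M ?\<gamma> t = tscale r (velocity M \<gamma> (r * t))" if "t \<in> {0..1}"
    using lift[OF that] by (auto simp: tscale_def)
  have "smooth_curve_on M {0..1} ?\<gamma>"
    unfolding smooth_curve_on_def
  proof (intro conjI ballI)
    have "continuous_on {0..1} \<gamma>"
      using \<gamma> by (simp add: geodesic_def smooth_curve_on_def)
    then show "continuous_on {0..1} ?\<gamma>"
      by (rule continuous_on_compose2) (use r01 in \<open>auto intro!: continuous_intros\<close>)
    fix \<kappa> assume \<kappa>: "\<kappa> \<in> atlas M"
    show "smooth_on ({0..1} \<inter> ?\<gamma> -` chart_dom \<kappa>) (chart_map \<kappa> \<circ> ?\<gamma>)"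
      unfolding smooth_on_def
    proof
      fix s assume s: "s \<in> {0..1} \<inter> ?\<gamma> -` chart_dom \<kappa>"
      have "smooth_on ({0..1} \<inter> \<gamma> -` chart_dom \<kappa>) (chart_map \<kappa> \<circ> \<gamma>)"
        using \<gamma> \<kappa> by (simp add: geodesic_def smooth_curve_on_def)
      moreover have "r * s \<in> {0..1} \<inter> \<gamma> -` chart_dom \<kappa>"
        using s r01 by simp
      ultimately obtain U h where U: "open U" "r * s \<in> U" "\<forall>k. Ck_on k U h"
        and h: "\<forall>y\<in>{0..1} \<inter> \<gamma> -` chart_dom \<kappa> \<inter> U. h y = (chart_map \<kappa> \<circ> \<gamma>) y"
        unfolding smooth_on_def by blast
      have "open ((\<lambda>t. r * t) -` U)"
        by (rule open_vimage[OF U(1)]) (intro continuous_intros)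
      moreover have "\<forall>k. Ck_on k ((\<lambda>t. r * t) -` U) (\<lambda>t. h (r * t))"
        using Ck_on_scale_arg[OF U(1)] U(3) by blast
      moreover have "h (r * y) = (chart_map \<kappa> \<circ> ?\<gamma>) y"
        if "y \<in> {0..1} \<inter> ?\<gamma> -` chart_dom \<kappa> \<inter> (\<lambda>t. r * t) -` U" for y
        using that h r01[of y] by simp
      ultimately show "\<exists>U h. open U \<and> s \<in> U \<and> (\<forall>k. Ck_on k U h) \<and>
          (\<forall>y\<in>{0..1} \<inter> ?\<gamma> -` chart_dom \<kappa> \<inter> U. h y = (chart_map \<kappa> \<circ> ?\<gamma>) y)"
        using U(2) by (intro exI[of _ "(\<lambda>t. r * t) -` U"] exI[of _ "\<lambda>t. h (r * t)"]) blast
    qed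
  qed
  then show "geodesic M ?\<gamma>"
    using lift by (auto simp: geodesic_def)
qed

lemma geodesic_solution_on:
  assumes \<gamma>: "geodesic M \<gamma>" and l: "chart_lift \<gamma> \<kappa> U h v a" and J: "J \<subseteq> U" "J \<subseteq> {0..1}"
    and B: "\<And>s. s \<in> J \<Longrightarrow> h s \<in> B" and \<kappa>: "\<kappa> \<in> atlas M"
  shows "coordinate_metric.solution_on (local_metric M \<kappa>) J B h v a"
proof -
  interpret coordinate_metric "chart_map \<kappa> ` chart_dom \<kappa>" "local_metric M \<kappa>"
    by (rule coordinate_metric[OF \<kappa>])
  note c = chart_liftD[OF l]
  show ?thesis
    unfolding solution_on_def
  proof (intro conjI ballI allI)
    show "continuous_on J a"
      by (rule continuous_on_subset[OF c(2) J(1)])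
    fix s w assume s: "s \<in> J"
    then have sU: "s \<in> U" "s \<in> {0..1}"
      using J by auto
    show "h s \<in> B" "(h has_vector_derivative v s) (at s)" "(v has_vector_derivative a s) (at s)"
      "local_metric M \<kappa> (h s) (a s) w = - koszul (h s) (v s) (v s) w"
      by (rule B[OF s] c(3)[OF sU(1)] c(4)[OF sU(1)] geodesic_lift_equation[OF \<gamma> l sU])+
  qed
qed

text \<open>Shaped for induction over the connected interval: agreement at any one time of
  \<open>T\<close>, not necessarily at \<open>t\<close>, spreads to all of \<open>T\<close>.\<close>

lemma geodesics_agree_locally:
  assumes 1: "geodesic M \<gamma>1" and 2: "geodesic M \<gamma>2" and t: "t \<in> {0..1}"
  defines "P \<equiv> \<lambda>s. \<gamma>1 s = \<gamma>2 s \<and> velocity M \<gamma>1 s = velocity M \<gamma>2 s"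
  shows "\<exists>T. openin (top_of_set {0..1}) T \<and> t \<in> T \<and> (\<forall>x\<in>T. \<forall>y\<in>T. P x \<longrightarrow> P y)"
proof (cases "\<gamma>1 t = \<gamma>2 t")
  case False
  then obtain A B where AB: "open A" "open B" "\<gamma>1 t \<in> A" "\<gamma>2 t \<in> B" "A \<inter> B = {}"
    using hausdorff by meson
  \<comment> \<open>The positions differ at every time of \<open>?T\<close>, so there is no
    agreement to spread.\<close>
  let ?T = "({0..1} \<inter> \<gamma>1 -` A) \<inter> ({0..1} \<inter> \<gamma>2 -` B)"
  have "continuous_on {0..1} \<gamma>1" "continuous_on {0..1} \<gamma>2"
    using 1 2 by (simp_all add: geodesic_def smooth_curve_on_def)
  then have "openin (top_of_set {0..1}) ?T"
    using AB(1,2) by (intro openin_Int continuous_openin_preimage_gen)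
  then show ?thesis
    using AB t by (intro exI[of _ ?T]) (auto simp: P_def)
next
  case True
  obtain \<kappa> where \<kappa>: "\<kappa> \<in> charts_at M (\<gamma>1 t)" "\<kappa> \<in> charts_at M (\<gamma>2 t)"
    using ex_chart[of "\<gamma>1 t"] True by auto
  let ?D = "chart_map \<kappa> ` chart_dom \<kappa>"
  have atl: "\<kappa> \<in> atlas M"
    by (rule charts_atD(1)[OF \<kappa>(1)])
  interpret coordinate_metric ?D "local_metric M \<kappa>"
    by (rule coordinate_metric[OF atl])
  obtain U1 h1 v1 a1 where l1: "chart_lift \<gamma>1 \<kappa> U1 h1 v1 a1" "t \<in> U1"
    using smooth_curve_chart[OF geodesic_smooth[OF 1] t \<kappa>(1)] by blast
  obtain U2 h2 v2 a2 where l2: "chart_lift \<gamma>2 \<kappa> U2 h2 v2 a2" "t \<in> U2"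
    using smooth_curve_chart[OF geodesic_smooth[OF 2] t \<kappa>(2)] by blast
  note c1 = chart_liftD[OF l1(1)] and c2 = chart_liftD[OF l2(1)]
  let ?x = "chart_map \<kappa> (\<gamma>1 t)"
  have ht: "h1 t = ?x" "h2 t = ?x"
    using c1(6)[OF l1(2) t] c2(6)[OF l2(2) t] True by simp_all
  have "?x \<in> ?D"
    using charts_atD(2)[OF \<kappa>(1)] by blast
  then obtain r where r: "r > 0" "cball ?x r \<subseteq> ?D"
    using open_dom open_contains_cball by blast
  have near: "\<exists>d>0. \<forall>s. dist t s \<le> d \<longrightarrow> s \<in> U \<and> h s \<in> cball ?x r"
    if U: "open U" "t \<in> U" and ht': "h t = ?x" and der: "(h has_vector_derivative w) (at t)" for U h and w :: 'e
  proof -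
    have "isCont h t"
      using der has_vector_derivative_continuous by blast
    then obtain d1 where d1: "d1 > 0" "\<forall>s. dist s t < d1 \<longrightarrow> dist (h s) (h t) < r"
      using r(1) unfolding continuous_at_eps_delta by blast
    obtain d2 where d2: "d2 > 0" "ball t d2 \<subseteq> U"
      using U openE by blast
    show ?thesis
    proof (intro exI[of _ "min d1 d2 / 2"] conjI allI impI)
      fix s assume "dist t s \<le> min d1 d2 / 2"
      then have "dist s t < d1" "s \<in> ball t d2"
        using d1(1) d2(1) by (auto simp: dist_commute)
      then show "s \<in> U" "h s \<in> cball ?x r"
        using d1(2) d2(2) ht' by (auto simp: dist_commute less_imp_le)
    qed (use d1 d2 in auto)
  qed
  obtain d1 where d1: "d1 > 0" "\<And>s. dist t s \<le> d1 \<Longrightarrow> s \<in> U1 \<and> h1 s \<in> cball ?x r"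
    using near[OF c1(1) l1(2) ht(1) c1(3)[OF l1(2)]] by blast
  obtain d2 where d2: "d2 > 0" "\<And>s. dist t s \<le> d2 \<Longrightarrow> s \<in> U2 \<and> h2 s \<in> cball ?x r"
    using near[OF c2(1) l2(2) ht(2) c2(3)[OF l2(2)]] by blast
  \<comment> \<open>A compact interval of times, a neighbourhood of \<open>t\<close> in [0,1], on
    which both lifts exist and stay in one closed ball inside the chart image.\<close>
  let ?J = "{0..1} \<inter> cball t (min d1 d2)"
  have J: "compact ?J" "is_interval ?J"
    unfolding is_interval_convex_1 by (intro compact_Int convex_Int; simp)+
  have JU: "s \<in> U1" "s \<in> U2" "h1 s \<in> cball ?x r" "h2 s \<in> cball ?x r" "s \<in> {0..1}" if "s \<in> ?J" for s
    using that d1(2)[of s] d2(2)[of s] by auto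
  have sub: "?J \<subseteq> U1" "?J \<subseteq> U2"
    using JU by blast+
  have s1: "solution_on ?J (cball ?x r) h1 v1 a1"
    by (rule geodesic_solution_on[OF 1 l1(1) sub(1) _ _ atl]) (use JU in auto)
  have s2: "solution_on ?J (cball ?x r) h2 v2 a2"
    by (rule geodesic_solution_on[OF 2 l2(1) sub(2) _ _ atl]) (use JU in auto)
  have "P y" if x: "x \<in> ?J" and y: "y \<in> ?J" and "P x" for x y
  proof -
    have "h1 x = h2 x"
      using \<open>P x\<close> c1(6)[OF JU(1,5)[OF x]] c2(6)[OF JU(2,5)[OF x]] by (simp add: P_def)
    moreover have "v1 x = v2 x"
      using \<open>P x\<close> c1(7)[OF JU(1,5)[OF x]] c2(7)[OF JU(2,5)[OF x]] by (simp add: P_def)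
    ultimately have eq: "h1 y = h2 y" "v1 y = v2 y"
      using solutions_agree[OF J r(2) s1 s2 x y] by auto
    note y1 = JU(1,5)[OF y] and y2 = JU(2,5)[OF y]
    have "chart_map \<kappa> (\<gamma>1 y) = chart_map \<kappa> (\<gamma>2 y)"
      using c1(6)[OF y1] c2(6)[OF y2] eq by simp
    then have "\<gamma>1 y = \<gamma>2 y"
      using chart_inv_chart_map[OF atl] charts_atD(2)[OF c1(5)[OF y1]] charts_atD(2)[OF c2(5)[OF y2]]
      by metis
    moreover have "velocity M \<gamma>1 y \<kappa> = velocity M \<gamma>2 y \<kappa>"
      using c1(7)[OF y1] c2(7)[OF y2] eq by simp
    ultimately show "P y"
      using tangent_space_eqI[OF _ _ c1(5)[OF y1]] velocity_in_tangent_space[OF geodesic_smooth[OF 1] y1(2)]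
        velocity_in_tangent_space[OF geodesic_smooth[OF 2] y1(2)]
      by (simp add: P_def)
  qed
  moreover have "openin (top_of_set {0..1}) ({0..1} \<inter> ball t (min d1 d2))"
    by (simp add: openin_open_Int)
  moreover have "{0..1} \<inter> ball t (min d1 d2) \<subseteq> ?J"
    using ball_subset_cball by blast
  moreover have "t \<in> {0..1} \<inter> ball t (min d1 d2)"
    using t d1(1) d2(1) by simp
  ultimately show ?thesis
    by (intro exI[of _ "{0..1} \<inter> ball t (min d1 d2)"]) blast
qed

lemma geodesic_unique:
  assumes "geodesic M \<gamma>1" "geodesic M \<gamma>2" "\<gamma>1 0 = \<gamma>2 0" "velocity M \<gamma>1 0 = velocity M \<gamma>2 0" "t \<in> {0..1}"
  shows "\<gamma>1 t = \<gamma>2 t"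
proof -
  have "\<gamma>1 t = \<gamma>2 t \<and> velocity M \<gamma>1 t = velocity M \<gamma>2 t"
    using connected_induction_simple[OF connected_Icc _ assms(5) _ geodesics_agree_locally[OF assms(1,2)], of 0]
      assms(3,4) by simp
  then show ?thesis ..
qed

text \<open>The curve slowed down by \<open>r\<close> is a geodesic with the required initial data,
  and uniqueness makes its end point the only value that the description admits.\<close>

lemma exp_map_geodesic:
  assumes \<gamma>: "geodesic M \<gamma>" and r: "r \<in> {0..1}"
  shows "exp_map M (\<gamma> 0) (tscale r (velocity M \<gamma> 0)) = \<gamma> r"
  unfolding exp_map_def
proof (rule the_equality)
  note resc = geodesic_rescale[OF \<gamma> r]
  have v: "velocity M (\<lambda>t. \<gamma> (r * t)) 0 = tscale r (velocity M \<gamma> 0)"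
    using resc(2)[of 0] by simp
  show "\<exists>\<gamma>'. geodesic M \<gamma>' \<and> \<gamma>' 0 = \<gamma> 0 \<and> velocity M \<gamma>' 0 = tscale r (velocity M \<gamma> 0) \<and> \<gamma>' 1 = \<gamma> r"
    using resc(1) v by (intro exI[of _ "\<lambda>t. \<gamma> (r * t)"]) simp
  fix y assume "\<exists>\<gamma>'. geodesic M \<gamma>' \<and> \<gamma>' 0 = \<gamma> 0 \<and> velocity M \<gamma>' 0 = tscale r (velocity M \<gamma> 0) \<and> \<gamma>' 1 = y"
  then obtain \<gamma>' where "geodesic M \<gamma>'" "\<gamma>' 0 = \<gamma> 0" "velocity M \<gamma>' 0 = tscale r (velocity M \<gamma> 0)" "\<gamma>' 1 = y"
    by blast
  then show "y = \<gamma> r"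
    using geodesic_unique[OF _ resc(1), of \<gamma>' 1] v by simp
qed

section \<open>The inverse exponential map\<close>

lemma exp_domain_geodesic:
  assumes "v \<in> exp_domain M x"
  obtains \<gamma> where "geodesic M \<gamma>" "\<gamma> 0 = x" "velocity M \<gamma> 0 = v"
    "\<And>r. r \<in> {0..1} \<Longrightarrow> exp_map M x (tscale r v) = \<gamma> r"
proof -
  obtain \<gamma> where "geodesic M \<gamma>" "\<gamma> 0 = x" "velocity M \<gamma> 0 = v"
    using assms unfolding exp_domain_def by blast
  with exp_map_geodesic[OF this(1)] that show ?thesis by blast
qed

text \<open>The two geodesics stay inside \<open>C\<close> by the definition of
  \<open>log_range\<close>, so uniqueness in \<open>C\<close> makes them equal on [0,1], and their
  one-sided velocities at 0 are equal too.\<close>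

lemma inj_on_exp_map:
  assumes "uniquely_geodesic M C"
  shows "inj_on (exp_map M x) (log_range M C x)"
proof (rule inj_onI)
  fix v w assume v: "v \<in> log_range M C x" and w: "w \<in> log_range M C x"
    and eq: "exp_map M x v = exp_map M x w"
  have one: "tscale 1 u = u" for u :: "('m, 'e) tvec"
    by (simp add: tscale_def)
  obtain \<gamma>1 where 1: "geodesic M \<gamma>1" "\<gamma>1 0 = x" "velocity M \<gamma>1 0 = v"
    "\<And>r. r \<in> {0..1} \<Longrightarrow> exp_map M x (tscale r v) = \<gamma>1 r"
    using v exp_domain_geodesic unfolding log_range_def by blast
  obtain \<gamma>2 where 2: "geodesic M \<gamma>2" "\<gamma>2 0 = x" "velocity M \<gamma>2 0 = w"
    "\<And>r. r \<in> {0..1} \<Longrightarrow> exp_map M x (tscale r w) = \<gamma>2 r"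
    using w exp_domain_geodesic unfolding log_range_def by blast
  let ?y = "exp_map M x v"
  have g1: "geodesic_in M C x ?y \<gamma>1"
    using v 1 1(4)[of 1] by (auto simp: geodesic_in_def log_range_def one)
  have g2: "geodesic_in M C x ?y \<gamma>2"
    using w 2 2(4)[of 1] eq by (auto simp: geodesic_in_def log_range_def one)
  have "x \<in> C" "?y \<in> C"
    using g1 v by (auto simp: geodesic_in_def log_range_def)
  then have "\<gamma>1 t = \<gamma>2 t" if "t \<in> {0..1}" for t
    using assms g1 g2 that unfolding uniquely_geodesic_def by blast
  then show "v = w"
    using velocity_cong[of 0 \<gamma>1 \<gamma>2 M] 1(3) 2(3) by simp
qed

text \<open>The exponential curve of the initial velocity retraces the geodesic, which puts that
  velocity into \<open>log_range\<close>; injectivity then identifies it. As the speed is constant,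
  the length is the initial speed.\<close>

lemma log_map_geodesic:
  assumes C: "uniquely_geodesically_convex M C" and "x \<in> C" "y \<in> C" and \<gamma>: "geodesic_in M C x y \<gamma>"
  shows "log_map M C x y = velocity M \<gamma> 0"
    and "rdist M x y = tnorm M x (velocity M \<gamma> 0)"
proof -
  have unique: "uniquely_geodesic M C"
    using C by (simp add: uniquely_geodesically_convex_def)
  obtain \<gamma>' where \<gamma>': "geodesic_in M C x y \<gamma>'" "minimizing M \<gamma>'"
    using C assms(2,3) unfolding uniquely_geodesically_convex_def geodesically_convex_def by blast
  have "\<gamma>' t = \<gamma> t" if "t \<in> {0..1}" for t
    using unique \<gamma> \<gamma>'(1) that assms(2,3) unfolding uniquely_geodesic_def by blast
  then have min: "minimizing M \<gamma>"
    by (rule minimizing_cong[OF \<gamma>'(2)])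
  have g: "geodesic M \<gamma>" "\<gamma> ` {0..1} \<subseteq> C" "\<gamma> 0 = x" "\<gamma> 1 = y"
    using \<gamma> by (auto simp: geodesic_in_def)
  have exp: "exp_map M x (tscale r (velocity M \<gamma> 0)) = \<gamma> r" if "r \<in> {0..1}" for r
    using exp_map_geodesic[OF g(1) that] g(3) by simp
  then have exp1: "exp_map M x (velocity M \<gamma> 0) = y"
    using exp[of 1] g(4) by (simp add: tscale_def)
  have "velocity M \<gamma> 0 \<in> exp_domain M x"
    using velocity_in_tangent_space[OF geodesic_smooth[OF g(1)], of 0] g unfolding exp_domain_def by auto
  moreover have "minimizing M (\<lambda>t. exp_map M x (tscale t (velocity M \<gamma> 0)))"
    by (rule minimizing_cong[OF min]) (simp add: exp)
  ultimately have "velocity M \<gamma> 0 \<in> log_range M C x"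
    using exp exp1 g(2) assms(3) unfolding log_range_def by auto
  then show "log_map M C x y = velocity M \<gamma> 0"
    unfolding log_map_def using exp1 by (intro the_inv_into_f_eq inj_on_exp_map[OF unique])
  show "rdist M x y = tnorm M x (velocity M \<gamma> 0)"
    using min geodesic_length[OF g(1)] g by (simp add: minimizing_def)
qed

end

section \<open>The gradient and the Frank-Wolfe step\<close>

lemma uminus_eq_tscale: "- v = tscale (- 1) v"
  by (simp add: tscale_def fun_eq_iff)

context riemannian_space
begin

text \<open>The chain rule for the transition map cancels against the transformation law of
  \<open>u\<close>. This makes the equations for \<open>grad\<close> in different charts
  consistent.\<close>

lemma frechet_derivative_chart_change:
  assumes f: "differentiable_at M f x" and \<kappa>: "\<kappa> \<in> charts_at M x" and \<kappa>': "\<kappa>' \<in> charts_at M x"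
    and u: "u \<in> tangent_space M x"
  shows "frechet_derivative (f \<circ> chart_inv \<kappa>') (at (chart_map \<kappa>' x)) (u \<kappa>')
    = frechet_derivative (f \<circ> chart_inv \<kappa>) (at (chart_map \<kappa> x)) (u \<kappa>)"
proof -
  let ?D = "\<lambda>\<kappa>. frechet_derivative (f \<circ> chart_inv \<kappa>) (at (chart_map \<kappa> x))"
  have D: "((f \<circ> chart_inv \<iota>) has_derivative ?D \<iota>) (at (chart_map \<iota> x))" if "\<iota> \<in> charts_at M x" for \<iota>
    using f that unfolding differentiable_at_def frechet_derivative_works by blast
  have "chart_map \<kappa>' x = (chart_map \<kappa>' \<circ> chart_inv \<kappa>) (chart_map \<kappa> x)"
    by (simp add: chart_inv_chart_map[OF charts_atD[OF \<kappa>]])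
  with D[OF \<kappa>'] have "((f \<circ> chart_inv \<kappa>') has_derivative ?D \<kappa>')
      (at ((chart_map \<kappa>' \<circ> chart_inv \<kappa>) (chart_map \<kappa> x)))"
    by simp
  from diff_chain_at[OF transition_has_derivative[OF \<kappa> \<kappa>'] this]
  have "((f \<circ> chart_inv \<kappa>) has_derivative ?D \<kappa>' \<circ> transition_deriv \<kappa> \<kappa>' x) (at (chart_map \<kappa> x))"
  proof (rule has_derivative_transform_within_open[OF _ open_overlap[OF charts_atD(1)[OF \<kappa>] charts_atD(1)[OF \<kappa>']]])
    show "chart_map \<kappa> x \<in> chart_map \<kappa> ` (chart_dom \<kappa> \<inter> chart_dom \<kappa>')"
      using charts_atD \<kappa> \<kappa>' by blast
  qed (auto simp: chart_inv_chart_map[OF charts_atD(1)[OF \<kappa>]] chart_inv_chart_map[OF charts_atD(1)[OF \<kappa>']])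
  from has_derivative_unique[OF this D[OF \<kappa>]]
  have "?D \<kappa>' (transition_deriv \<kappa> \<kappa>' x (u \<kappa>)) = ?D \<kappa> (u \<kappa>)"
    by (simp add: fun_eq_iff)
  moreover have "u \<kappa>' = transition_deriv \<kappa> \<kappa>' x (u \<kappa>)"
    using u \<kappa> \<kappa>' unfolding tangent_space_def by blast
  ultimately show ?thesis by simp
qed

text \<open>Representing the differential through the metric in one chart gives a candidate; chart
  independence verifies the equation in all others, and the same chart shows uniqueness. The
  definite description therefore inherits membership.\<close>

lemma grad_in_tangent_space:
  assumes f: "differentiable_at M f x"
  shows "grad M f x \<in> tangent_space M x"
proof -
  obtain \<kappa> where \<kappa>: "\<kappa> \<in> charts_at M x"
    using ex_chart by blast
  let ?x = "chart_map \<kappa> x"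
  let ?l = "frechet_derivative (f \<circ> chart_inv \<kappa>) (at ?x)"
  interpret coordinate_metric "chart_map \<kappa> ` chart_dom \<kappa>" "local_metric M \<kappa>"
    using coordinate_metric charts_atD(1)[OF \<kappa>] by blast
  have dom: "?x \<in> chart_map \<kappa> ` chart_dom \<kappa>"
    using charts_atD(2)[OF \<kappa>] by blast
  have "linear ?l"
    using f \<kappa> unfolding differentiable_at_def frechet_derivative_works
    by (blast intro: has_derivative_linear)
  from bilinear_form_representation[OF bilinear[OF dom] pos[OF dom] this]
  obtain z where z: "\<And>w. local_metric M \<kappa> ?x z w = ?l w"
    and z_unique: "\<And>z'. (\<And>w. local_metric M \<kappa> ?x z' w = ?l w) \<Longrightarrow> z' = z"
    by blast
  note t = coord_vec_in_tangent_space[OF \<kappa>]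
  let ?P = "\<lambda>w. w \<in> tangent_space M x \<and> (\<forall>u\<in>tangent_space M x. \<forall>\<kappa>'\<in>charts_at M x.
      metric M x w u = frechet_derivative (f \<circ> chart_inv \<kappa>') (at (chart_map \<kappa>' x)) (u \<kappa>'))"
  have "?P (coord_vec M \<kappa> x z)"
  proof (intro conjI ballI)
    fix u \<kappa>' assume u: "u \<in> tangent_space M x" and \<kappa>': "\<kappa>' \<in> charts_at M x"
    have "metric M x (coord_vec M \<kappa> x z) u = ?l (u \<kappa>)"
      by (simp add: metric_eq_local_metric[OF \<kappa> t u] coord_vec_self[OF \<kappa>] z)
    then show "metric M x (coord_vec M \<kappa> x z) u
        = frechet_derivative (f \<circ> chart_inv \<kappa>') (at (chart_map \<kappa>' x)) (u \<kappa>')"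
      using frechet_derivative_chart_change[OF f \<kappa> \<kappa>' u] by simp
  qed (rule t)
  moreover have "w = coord_vec M \<kappa> x z" if w: "?P w" for w
  proof (rule tangent_space_eqI[OF _ t \<kappa>])
    have "local_metric M \<kappa> ?x (w \<kappa>) v = ?l v" for v
      using w \<kappa> t[of v] metric_eq_local_metric[OF \<kappa> _ t[of v], of w] by (simp add: coord_vec_self[OF \<kappa>])
    then show "w \<kappa> = coord_vec M \<kappa> x z \<kappa>"
      using z_unique by (simp add: coord_vec_self[OF \<kappa>])
  qed (use w in blast)
  ultimately have "\<exists>!w. ?P w"
    by blast
  from theI'[OF this] show ?thesis
    unfolding grad_def by blast
qed

section \<open>The inverse exponential map along geodesics in \<open>C\<close> and first-order
  convexity\<close>

lemma ex_geodesic_in: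
  assumes "uniquely_geodesically_convex M C" "x \<in> C" "y \<in> C"
  obtains \<gamma> where "geodesic_in M C x y \<gamma>"
  using assms unfolding uniquely_geodesically_convex_def geodesically_convex_def by blast

lemma log_map_in_tangent_space:
  assumes C: "uniquely_geodesically_convex M C" and "x \<in> C" "y \<in> C"
  shows "log_map M C x y \<in> tangent_space M x"
proof -
  obtain \<gamma> where \<gamma>: "geodesic_in M C x y \<gamma>"
    using ex_geodesic_in[OF assms] .
  then show ?thesis
    using log_map_geodesic(1)[OF assms \<gamma>] velocity_in_tangent_space[of \<gamma> 0]
    by (auto simp: geodesic_in_def geodesic_def)
qed

lemma rdist_eq_tnorm_log_map:
  assumes "uniquely_geodesically_convex M C" "x \<in> C" "y \<in> C"
  shows "rdist M x y = tnorm M x (log_map M C x y)"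
  using ex_geodesic_in[OF assms] log_map_geodesic[OF assms] by metis

text \<open>The slowed-down curve is the geodesic in \<open>C\<close> that ends at
  \<open>\<gamma> s\<close>, and its initial velocity is \<open>s\<close> times that of
  \<open>\<gamma>\<close>.\<close>

lemma log_map_along_geodesic:
  assumes C: "uniquely_geodesically_convex M C" and "x \<in> C" "y \<in> C" and \<gamma>: "geodesic_in M C x y \<gamma>"
    and s: "s \<in> {0..1}"
  shows "log_map M C x (\<gamma> s) = tscale s (log_map M C x y)"
    and "rdist M x (\<gamma> s) = s * rdist M x y"
proof -
  have g: "geodesic M \<gamma>" "\<gamma> ` {0..1} \<subseteq> C" "\<gamma> 0 = x"
    using \<gamma> by (auto simp: geodesic_in_def)
  have "s * t \<in> {0..1}" if "t \<in> {0..1}" for t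
    using s that by (auto intro: mult_le_one)
  then have s_in: "geodesic_in M C x (\<gamma> s) (\<lambda>t. \<gamma> (s * t))"
    using geodesic_rescale(1)[OF g(1) s] g by (auto simp: geodesic_in_def)
  have sC: "\<gamma> s \<in> C"
    using g(2) s by blast
  show log: "log_map M C x (\<gamma> s) = tscale s (log_map M C x y)"
    using log_map_geodesic(1)[OF C assms(2) sC s_in] log_map_geodesic(1)[OF C assms(2,3) \<gamma>]
      geodesic_rescale(2)[OF g(1) s, of 0] by simp
  show "rdist M x (\<gamma> s) = s * rdist M x y"
    using s by (simp add: rdist_eq_tnorm_log_map[OF C assms(2)] sC assms(3) log
        tnorm_scale[OF log_map_in_tangent_space[OF C assms(2,3)]])
qed

text \<open>Geodesic smoothness along the geodesic from \<open>x\<close> to \<open>y\<close> replaces differentiation at \<open>x\<close>: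
  its error is quadratic in the time and disappears after division by the time.\<close>

lemma convex_first_order:
  assumes C: "uniquely_geodesically_convex M C" and "x \<in> C" "y \<in> C"
    and f: "differentiable_at M f x" "geodesically_convex_fun M C f" "geodesically_smooth M C L f"
    and "L > 0"
  shows "metric M x (grad M f x) (log_map M C x y) \<le> f y - f x"
proof (rule field_le_epsilon)
  fix e :: real assume "e > 0"
  let ?m = "metric M x (grad M f x) (log_map M C x y)"
  obtain \<gamma> where \<gamma>: "geodesic_in M C x y \<gamma>"
    using ex_geodesic_in[OF assms(1-3)] .
  define K where "K = L / 2 * (rdist M x y)\<^sup>2"
  \<comment> \<open>Chosen so that the error left after division by \<open>s\<close>, namely
    \<open>s * K\<close>, is at most \<open>e\<close>; adding 1 keeps the denominator positive if
    \<open>K = 0\<close>.\<close>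
  define s where "s = min 1 (e / (K + 1))"
  have "K \<ge> 0"
    using \<open>L > 0\<close> by (simp add: K_def)
  have s: "0 < s" "s \<le> 1"
    using \<open>K \<ge> 0\<close> \<open>e > 0\<close> by (auto simp: s_def)
  have "s \<le> e / (K + 1)"
    by (simp add: s_def)
  then have "s * (K + 1) \<le> e"
    using \<open>K \<ge> 0\<close> by (simp add: field_simps)
  then have sK: "s * K \<le> e"
    using s by (simp add: distrib_left)
  have s01: "s \<in> {0..1}"
    using s by simp
  have "\<gamma> s \<in> C"
    using \<gamma> s01 by (auto simp: geodesic_in_def)
  then have "\<bar>f (\<gamma> s) - f x - s * ?m\<bar> \<le> L / 2 * (s * rdist M x y)\<^sup>2"
    using f(3) assms(2) log_map_along_geodesic[OF assms(1-3) \<gamma> s01]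
      metric_scale_right[OF grad_in_tangent_space[OF f(1)] log_map_in_tangent_space[OF assms(1-3)], of s]
    unfolding geodesically_smooth_def by metis
  then have "s * ?m \<le> f (\<gamma> s) - f x + s * (s * K)"
    unfolding abs_le_iff by (simp add: K_def power2_eq_square algebra_simps)
  also have "f (\<gamma> s) \<le> (1 - s) * f x + s * f y"
    using f(2) assms(2,3) \<gamma> s01 unfolding geodesically_convex_fun_def by blast
  finally have "s * ?m \<le> s * (f y - f x + s * K)"
    by (simp add: algebra_simps)
  then have "?m \<le> f y - f x + s * K"
    using s(1) by simp
  then show "?m \<le> f y - f x + e"
    using sK by linarith
qed

end

text \<open>Here \<open>h\<close> is the optimality gap, \<open>m\<close> the slope towards the
  chosen vertex, \<open>d\<close> its distance and \<open>b\<close> stands for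
  \<open>\<alpha> * c\<close>. If \<open>r * L \<le> b\<close>, the quadratic term at
  \<open>r\<close> is at most \<open>r * b / 2\<close> times the squared distance, hence at most
  \<open>- r * m / 2\<close>; what remains is \<open>r * m / 2 \<le> - r * h / 2\<close>.\<close>

lemma frank_wolfe_step_decrease:
  fixes m d L b h s :: real
  assumes "L > 0" "b > 0" "h \<ge> 0" "h \<le> - m" "b * d\<^sup>2 \<le> - m"
    and s: "\<And>r. r \<in> {0..1} \<Longrightarrow> s * m + s\<^sup>2 * (L / 2) * d\<^sup>2 \<le> r * m + r\<^sup>2 * (L / 2) * d\<^sup>2"
  shows "h + (s * m + s\<^sup>2 * (L / 2) * d\<^sup>2) \<le> h * max (1 / 2) (1 - b / (2 * L))"
proof -
  \<comment> \<open>The largest element of [0,1] with \<open>r * L \<le> b\<close>.\<close>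
  define r where "r = min 1 (b / L)"
  have r: "0 \<le> r" "r \<le> 1" "r * L \<le> b"
    using assms(1,2) by (auto simp: r_def min_def field_simps)
  have "s * m + s\<^sup>2 * (L / 2) * d\<^sup>2 \<le> r * m + r * (r * L) * d\<^sup>2 / 2"
    using s[of r] r by (simp add: power2_eq_square mult_ac)
  also have "r * (r * L) * d\<^sup>2 \<le> r * b * d\<^sup>2"
    using r by (intro mult_right_mono mult_left_mono) auto
  also have "r * b * d\<^sup>2 \<le> r * - m"
    using r(1) assms(5) by (simp only: mult.assoc mult_left_mono)
  also have "r * m + r * - m / 2 = r * m / 2"
    by simp
  also have "\<dots> \<le> r * - h / 2"
    using r(1) assms(4) mult_left_mono[of m "- h" r] by simp
  finally have "h + (s * m + s\<^sup>2 * (L / 2) * d\<^sup>2) \<le> h * (1 - r / 2)"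
    by (simp add: algebra_simps)
  \<comment> \<open>\<open>r / 2\<close> is the smaller of \<open>1 / 2\<close> and
    \<open>b / (2 * L)\<close>, so \<open>1 - r / 2\<close> is the larger of the two
    factors.\<close>
  also have "\<dots> = h * max (1 / 2) (1 - b / (2 * L))"
    using assms(1) by (auto simp: r_def min_def max_def field_simps)
  finally show ?thesis .
qed

theorem theorem7p1:
  fixes M :: "('m::{t2_space,second_countable_topology}, 'e::euclidean_space) riemannian"
    and C :: "'m set" and f :: "'m \<Rightarrow> real" and L c \<alpha> :: real
    and xstar :: 'm and xs :: "nat \<Rightarrow> 'm"
  assumes "riemannian_manifold M"
    and "compact C" and "uniquely_geodesically_convex M C"
    and "\<forall>x\<in>C. differentiable_at M f x"
    and "geodesically_convex_fun M C f"
    and "L > 0" and "geodesically_smooth M C L f"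
    and "\<forall>x. (\<forall>y. f x \<le> f y) \<longrightarrow> x \<notin> C"
    and "c > 0" and "\<forall>x\<in>C. tnorm M x (grad M f x) > c"
    and "\<alpha> > 0" and "riemannian_scaling_inequality M C \<alpha>"
    and "is_arg_min f (\<lambda>x. x \<in> C) xstar"
    and "riemannian_frank_wolfe M C L f xs"
  shows "\<forall>t. f (xs (Suc t)) - f xstar
           \<le> (f (xs t) - f xstar) * max (1 / 2) (1 - \<alpha> * c / (2 * L))"
proof
  interpret riemannian_space M
    by standard (rule assms(1))
  note C = assms(3)
  have star: "xstar \<in> C" "\<And>y. y \<in> C \<Longrightarrow> f xstar \<le> f y"
    using assms(13) by (auto simp: is_arg_min_linorder)
  have step: "\<exists>v s \<gamma>.
      is_arg_max (\<lambda>z. metric M (xs t) (- grad M f (xs t)) (log_map M C (xs t) z)) (\<lambda>z. z \<in> C) v \<and>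
      is_arg_min (\<lambda>r. r * metric M (xs t) (grad M f (xs t)) (log_map M C (xs t) v)
                      + r\<^sup>2 * (L / 2) * (rdist M (xs t) v)\<^sup>2) (\<lambda>r. r \<in> {0..1}) s \<and>
      geodesic_in M C (xs t) v \<gamma> \<and> xs (Suc t) = \<gamma> s" for t
    using assms(14) unfolding riemannian_frank_wolfe_def by blast
  have xC: "xs t \<in> C" for t
  proof (induction t)
    case 0
    then show ?case
      using assms(14) by (simp add: riemannian_frank_wolfe_def)
  next
    case (Suc t)
    then show ?case
      using step[of t] unfolding is_arg_min_def geodesic_in_def by blast
  qed
  fix t
  define x where "x = xs t"
  have x: "x \<in> C"
    by (simp add: x_def xC)
  obtain v s \<gamma> where
    v: "is_arg_max (\<lambda>z. metric M x (- grad M f x) (log_map M C x z)) (\<lambda>z. z \<in> C) v" and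
    s: "is_arg_min (\<lambda>r. r * metric M x (grad M f x) (log_map M C x v)
          + r\<^sup>2 * (L / 2) * (rdist M x v)\<^sup>2) (\<lambda>r. r \<in> {0..1}) s" and
    \<gamma>: "geodesic_in M C x v \<gamma>" "xs (Suc t) = \<gamma> s"
    using step[of t] unfolding x_def by blast
  have vC: "v \<in> C"
    using v by (simp add: is_arg_max_def)
  have s01: "s \<in> {0..1}"
    using s by (simp add: is_arg_min_def)
  have grad: "grad M f x \<in> tangent_space M x"
    using grad_in_tangent_space assms(4) x by blast
  have ngrad: "- grad M f x \<in> tangent_space M x"
    unfolding uminus_eq_tscale by (rule tscale_in_tangent_space[OF grad])
  have neg: "metric M x (- grad M f x) (log_map M C x z) = - metric M x (grad M f x) (log_map M C x z)"
    if "z \<in> C" for z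
    unfolding uminus_eq_tscale
    using metric_scale[OF grad log_map_in_tangent_space[OF C x that], of "- 1"] by simp
  let ?m = "metric M x (grad M f x) (log_map M C x v)"
  let ?q = "\<lambda>r. r * ?m + r\<^sup>2 * (L / 2) * (rdist M x v)\<^sup>2"
  have "f x - f xstar \<le> - metric M x (grad M f x) (log_map M C x xstar)"
    using convex_first_order[OF C x star(1) _ assms(5,7,6)] assms(4) x by fastforce
  \<comment> \<open>\<open>xstar\<close> is a competitor in the maximisation that selects
    \<open>v\<close>.\<close>
  also have "\<dots> \<le> - ?m"
    using v star(1) neg[OF vC] neg[OF star(1)] by (auto simp: is_arg_max_linorder)
  finally have gap: "f x - f xstar \<le> - ?m" .
  \<comment> \<open>The gradient bound turns the scaling inequality for
    \<open>w = - grad M f x\<close> into a multiple of the squared distance whose constant is the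
    same for every iterate.\<close>
  have "\<alpha> * c * (rdist M x v)\<^sup>2 \<le> \<alpha> * tnorm M x (- grad M f x) * (rdist M x v)\<^sup>2"
    using assms(10,11) x tnorm_scale[OF grad, of "- 1"]
    by (intro mult_right_mono mult_left_mono) (auto simp: uminus_eq_tscale less_imp_le)
  also have "\<dots> \<le> metric M x (- grad M f x) (log_map M C x v)"
    using assms(12) x ngrad v unfolding riemannian_scaling_inequality_def rdist_eq_tnorm_log_map[OF C x vC]
    by blast
  finally have scaling: "\<alpha> * c * (rdist M x v)\<^sup>2 \<le> - ?m"
    by (simp add: neg[OF vC])
  have "\<gamma> s \<in> C"
    using \<gamma>(1) s01 by (auto simp: geodesic_in_def)
  \<comment> \<open>Slope and distance both scale by \<open>s\<close> along the geodesic, so the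
    smoothness estimate at the new iterate bounds the change of \<open>f\<close> by the model value
    \<open>?q s\<close>.\<close>
  then have "\<bar>f (\<gamma> s) - f x - s * ?m\<bar> \<le> L / 2 * (s * rdist M x v)\<^sup>2"
    using assms(7) x log_map_along_geodesic[OF C x vC \<gamma>(1) s01]
      metric_scale_right[OF grad log_map_in_tangent_space[OF C x vC], of s]
    unfolding geodesically_smooth_def by metis
  then have "f (xs (Suc t)) - f xstar \<le> f x - f xstar + ?q s"
    using \<gamma>(2) unfolding abs_le_iff by (simp add: power_mult_distrib algebra_simps)
  also have "\<dots> \<le> (f x - f xstar) * max (1 / 2) (1 - \<alpha> * c / (2 * L))"
  proof (rule frank_wolfe_step_decrease[OF assms(6) _ _ gap scaling])
    show "?q s \<le> ?q r" if "r \<in> {0..1}" for r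
      using s that by (auto simp: is_arg_min_linorder)
  qed (use assms(9,11) star(2)[OF x] in auto)
  finally show "f (xs (Suc t)) - f xstar \<le> (f (xs t) - f xstar) * max (1 / 2) (1 - \<alpha> * c / (2 * L))"
    by (simp add: x_def)
qed

end
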